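(* Let $H_n$ be the height of a random symmetric digital search tree of size $n$, and define \[ k_H=\left\lfloor \log_2n+\sqrt{2\log_2n}-\frac12\log_2\log_2n+\frac1{\log 2}\right\rfloor . \] Then the distribution of $H_n$ is concentrated at the two points $k_H$ and $k_H+1$: \[ \mathbb{P}(H_n=k_H\text{ or }H_n=k_H+1)\to1,\qquad(n\to\infty). \]
   Context: Here $\log$ is the natural logarithm and $\log_2$ the logarithm to base $2$. Random symmetric digital search tree (DST) of size $n$: one is given a sequence of $n$ records, each an infinite string of bits, all bits of all records being independent and uniform on $\{0,1\}$. If $n=0$ the tree is a single external node. If $n\ge1$, the first record is stored in the root (an internal node, at level $0$); the remaining $n-1$ records are distributed, retaining their relative order, to the left or right subtree according as their first bit is $0$ or $1$; the subtrees are built recursively by the same rule, using the next bit at each level. Thus the tree is a binary tree with $n$ internal nodes (holding the records) and $n+1$ external nodes (empty places). $B_{n,k}$ is the number of external nodes at level (distance from the root) $k$. The height is $H_n=\max\{k:B_{n,k}>0\}$, the length of the longest path from the root to an external node. *)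

theory Defs
  imports "HOL-Probability.Probability" "HOL-Library.Tree"
begin

text \<open>A record is an infinite bit string; bit \<open>False\<close> stands for 0, bit \<open>True\<close> for 1.\<close>

type_synonym bitstring = "nat \<Rightarrow> bool"

text \<open>
  \<open>dst_at d rs\<close> is the digital search tree built from \<open>rs\<close> by a node at level \<open>d\<close>, where
  bit \<open>d\<close> decides the branching. \<open>Node\<close> is an internal and \<open>Leaf\<close> an external node.
\<close>

fun dst_at :: "nat \<Rightarrow> bitstring list \<Rightarrow> bitstring tree" where
  "dst_at d [] = Leaf"
| "dst_at d (r # rs) =
     Node (dst_at (Suc d) (filter (\<lambda>s. \<not> s d) rs)) r (dst_at (Suc d) (filter (\<lambda>s. s d) rs))"

definition dst :: "bitstring list \<Rightarrow> bitstring tree" where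
  "dst rs = dst_at 0 rs"

fun external_nodes :: "'a tree \<Rightarrow> nat \<Rightarrow> nat" where
  "external_nodes Leaf 0 = 1"
| "external_nodes Leaf (Suc k) = 0"
| "external_nodes (Node l x r) 0 = 0"
| "external_nodes (Node l x r) (Suc k) = external_nodes l k + external_nodes r k"

definition ext_height :: "'a tree \<Rightarrow> nat" where
  "ext_height t = Max {k. external_nodes t k > 0}"

lemma external_nodes_eq_0: "height t < k \<Longrightarrow> external_nodes t k = 0"
  by (induction t k rule: external_nodes.induct) auto

lemma external_nodes_height_pos: "external_nodes t (height t) > 0"
  by (induction t) (auto simp: max_def)

lemma ext_height_eq_height: "ext_height t = height t"
  unfolding ext_height_def
proof (rule Max_eqI)
  have le: "k \<le> height t" if "external_nodes t k > 0" for k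
    using external_nodes_eq_0[of t k] that by (cases "height t < k") auto
  show "finite {k. external_nodes t k > 0}"
    by (rule finite_subset[of _ "{..height t}"]) (auto simp: le)
  show "k \<le> height t" if "k \<in> {k. external_nodes t k > 0}" for k
    using that le by simp
qed (simp add: external_nodes_height_pos)

lemma size_dst: "size (dst rs) = length rs"
proof -
  have "size (dst_at d rs) = length rs" for d
    by (induction d rs rule: dst_at.induct)
       (use sum_length_filter_compl in \<open>auto simp: add.commute\<close>)
  then show ?thesis by (simp add: dst_def)
qed

text \<open>\<open>b i j\<close> is bit \<open>j\<close> of record \<open>i\<close>, for the \<open>n\<close> records \<open>i < n\<close>.\<close>

definition random_bits :: "'w measure \<Rightarrow> nat \<Rightarrow> (nat \<Rightarrow> nat \<Rightarrow> 'w \<Rightarrow> bool) \<Rightarrow> bool" where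
  "random_bits M n b \<longleftrightarrow>
     prob_space M \<and>
     prob_space.indep_vars M (\<lambda>_. count_space UNIV) (\<lambda>(i, j). b i j) ({..<n} \<times> UNIV) \<and>
     (\<forall>i<n. \<forall>j. \<P>(\<omega> in M. b i j \<omega>) = 1 / 2)"

definition dst_height :: "nat \<Rightarrow> (nat \<Rightarrow> nat \<Rightarrow> 'w \<Rightarrow> bool) \<Rightarrow> 'w \<Rightarrow> nat" where
  "dst_height n b \<omega> = ext_height (dst (map (\<lambda>i j. b i j \<omega>) [0..<n]))"

definition k_H :: "nat \<Rightarrow> int" where
  "k_H n = \<lfloor>log 2 (real n) + sqrt (2 * log 2 (real n)) - 1 / 2 * log 2 (log 2 (real n)) + 1 / ln 2\<rfloor>"

end

theory Submission
  imports Defs "HOL-Probability.Product_PMF" "HOL-Real_Asymp.Real_Asymp"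
begin

text \<open>
  Write \<open>L = log\<^sub>2 n\<close>, \<open>S = sqrt (2 L)\<close> and \<open>x\<close> for the number whose integer part is \<open>k_H n\<close>. The
  height exceeds \<open>k\<close> iff some record sits at level \<open>k\<close>. Two estimates suffice: the probability of
  this tends to 0 for \<open>k \<ge> x\<close> and to 1 for \<open>k \<le> x - 1\<close>. Since \<open>k_H n + 1 > x\<close> and
  \<open>k_H n - 1 \<le> x - 1\<close>, the height is then \<open>k_H n\<close> or \<open>k_H n + 1\<close>.

  Only the distribution function \<open>height_cdf k n\<close> of the height matters. Splitting the records
  after the first one by their leading bit shows that it satisfies a binomial convolution recurrence
  (\<open>prob_height_within\<close>, \<open>prob_dst_height_le\<close>), and from there on the argument is analytic.

  Upper tail. If a record sits at level \<open>k\<close>, then its last \<open>f + 1\<close> ancestors (itself included) form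
  a chain of records with growing common prefixes. The expected number of such chains is
  \<open>2 powr (f (f + 1) / 2 - f k) * (n choose (f + 1))\<close>, and \<open>height_tail_partial_chain\<close> derives this
  bound from the recurrence. With \<open>f + 1\<close> close to \<open>S\<close> and \<open>k \<ge> x\<close> all terms of order \<open>S\<^sup>2\<close>,
  \<open>S log S\<close> and \<open>S\<close> in the exponent cancel, and a bound of order \<open>1 / S\<close> is left
  (\<open>height_tail_above_threshold\<close>). The summands of \<open>x\<close> are exactly what this cancellation needs.

  Lower tail. With a Poisson number of records of mean \<open>z\<close>, the two subtrees of the root have
  independent Poisson sizes of mean \<open>z / 2\<close> once the root is filled; for the Poisson transform
  \<open>poisson_cdf\<close> this is the differential equation \<open>gen (h + 1)' z = (gen h (z / 2))\<^sup>2\<close>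
  (\<open>gen_deriv\<close>). It gives three estimates, used from the leaves upwards. At the bottom, where
  the mean size is at most 1, the tail is, up to a constant factor, at least the first term of its power
  series, which has the same coefficient as the upper bound (\<open>gen_gap\<close>). On the next \<open>r\<close> levels, with
  \<open>2 ^ r\<close> about \<open>L\<^sup>2\<close>, one follows a single subtree and loses only a constant factor per level
  (\<open>poisson_tail_levels\<close>). On the remaining levels, with mean sizes so large that fluctuations
  do not matter, every level squares the probability of staying low (\<open>poisson_cdf_squaring\<close>): a tree
  of height at most \<open>k\<close> needs about \<open>n / L\<^sup>2\<close> independent subtrees that all stay low. For
  \<open>k \<le> x - 1\<close> the expected number of high subtrees is exponentially large in \<open>S\<close>, so the
  probability that there is none decays faster than every power of \<open>n\<close>. This is why the return
  from Poisson size to size \<open>n\<close> may lose a factor \<open>n\<close> (\<open>height_cdf_le_poisson\<close>).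
\<close>

section \<open>The recurrence for the distribution function of the height\<close>

text \<open>
  The probability that a tree of \<open>n\<close> records has height at most \<open>h\<close>: after the first record is placed
  in the root, the sizes of the two subtrees of the remaining \<open>n\<close> are binomially distributed.
  That this is the law of the height is shown in \<open>prob_dst_height_le\<close>.
\<close>

fun height_cdf :: "nat \<Rightarrow> nat \<Rightarrow> real" where
  "height_cdf h 0 = 1"
| "height_cdf 0 (Suc n) = 0"
| "height_cdf (Suc h) (Suc n) =
     (\<Sum>j\<le>n. (n choose j) / 2 ^ n * height_cdf h j * height_cdf h (n - j))"

lemma binomial_average_one: "(\<Sum>j\<le>n. (n choose j) / 2 ^ n) = (1 :: real)"
proof -
  have "(\<Sum>j\<le>n. real (n choose j)) = 2 ^ n"
    using choose_row_sum[of n] by (metis of_nat_sum of_nat_numeral of_nat_power)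
  then show ?thesis by (simp add: sum_divide_distrib[symmetric])
qed

lemma height_cdf_bounds: "0 \<le> height_cdf h n \<and> height_cdf h n \<le> 1"
proof (induction h n rule: height_cdf.induct)
  case (3 h n)
  have "height_cdf (Suc h) (Suc n) \<le> (\<Sum>j\<le>n. (n choose j) / 2 ^ n * 1 * 1)"
    unfolding height_cdf.simps
    by (intro sum_mono mult_mono) (use 3 in auto)
  also have "\<dots> = 1" by (simp add: binomial_average_one)
  finally show ?case using 3 by (auto intro!: sum_nonneg)
qed auto

lemma height_cdf_nonneg: "0 \<le> height_cdf h n"
  and height_cdf_le_1: "height_cdf h n \<le> 1"
  using height_cdf_bounds by auto

text \<open>
  A binary tree of height \<open>h\<close> has at most \<open>2 ^ h - 1\<close> internal nodes.
\<close>

lemma height_cdf_eq_0: "2 ^ h \<le> n \<Longrightarrow> height_cdf h n = 0"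
proof (induction h n rule: height_cdf.induct)
  case (3 h n)
  have "2 ^ h \<le> j \<or> 2 ^ h \<le> n - j" if "j \<le> n" for j
    using 3(3) that by auto
  then show ?case using 3 by (fastforce intro!: sum.neutral)
qed auto

section \<open>The height of the random tree follows the recurrence\<close>

abbreviation coins :: "'i set \<Rightarrow> ('i \<Rightarrow> bool) pmf" where
  "coins A \<equiv> Pi_pmf A False (\<lambda>_. bernoulli_pmf (1 / 2))"

text \<open>
  Independence of events is obtained from disjointness of the sets of bits that determine them. On
  finitely many bits every event is measurable, so these sets are all that has to be tracked.
\<close>

definition depends_on :: "(('i \<Rightarrow> bool) \<Rightarrow> bool) \<Rightarrow> 'i set \<Rightarrow> bool" where
  "depends_on P A \<longleftrightarrow> (\<forall>s t. (\<forall>x\<in>A. s x = t x) \<longrightarrow> P s = P t)"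

lemma depends_onD: "depends_on P A \<Longrightarrow> (\<And>x. x \<in> A \<Longrightarrow> s x = t x) \<Longrightarrow> P s = P t"
  by (auto simp: depends_on_def)

lemma depends_on_mono: "depends_on P A \<Longrightarrow> A \<subseteq> B \<Longrightarrow> depends_on P B"
  by (auto simp: depends_on_def)

lemma prob_coins_conj:
  assumes fin: "finite A" "finite B" and disj: "A \<inter> B = {}"
      and P: "depends_on P A" and Q: "depends_on Q B"
  shows "measure_pmf.prob (coins (A \<union> B)) {s. P s \<and> Q s} =
         measure_pmf.prob (coins A) {s. P s} * measure_pmf.prob (coins B) {s. Q s}"
proof -
  have eq: "coins (A \<union> B) =
        map_pmf (\<lambda>(f, g) x. if x \<in> A then f x else g x) (pair_pmf (coins A) (coins B))"
    by (rule Pi_pmf_union[OF fin disj])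
  have Pf: "P (\<lambda>x. if x \<in> A then f x else g x) = P f" for f g
    by (rule depends_onD[OF P]) simp
  have Qg: "Q (\<lambda>x. if x \<in> A then f x else g x) = Q g" for f g
    by (rule depends_onD[OF Q]) (use disj in auto)
  have vi: "(\<lambda>(f, g) x. if x \<in> A then f x else g x) -` {s. P s \<and> Q s} = {s. P s} \<times> {s. Q s}"
    by (rule set_eqI) (simp only: vimage_eq mem_Collect_eq case_prod_unfold mem_Times_iff Pf Qg)
  have c: "{s. P s} \<times> {s. Q s} \<inter> set_pmf (pair_pmf (coins A) (coins B)) =
     ({s. P s} \<inter> set_pmf (coins A)) \<times> ({s. Q s} \<inter> set_pmf (coins B))"
    by auto
  have "measure_pmf.prob (coins (A \<union> B)) {s. P s \<and> Q s} =
      measure_pmf.prob (pair_pmf (coins A) (coins B)) ({s. P s} \<times> {s. Q s})"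
    by (simp only: eq measure_map_pmf vi)
  also have "\<dots> = measure_pmf.prob (pair_pmf (coins A) (coins B))
     (({s. P s} \<inter> set_pmf (coins A)) \<times> ({s. Q s} \<inter> set_pmf (coins B)))"
    by (subst measure_Int_set_pmf[symmetric]) (simp only: c)
  also have "\<dots> = measure_pmf.prob (coins A) ({s. P s} \<inter> set_pmf (coins A)) *
       measure_pmf.prob (coins B) ({s. Q s} \<inter> set_pmf (coins B))"
    by (rule measure_pmf_prob_product) auto
  finally show ?thesis by (simp add: measure_Int_set_pmf)
qed

lemma prob_coins_restrict:
  assumes fin: "finite B" and sub: "A \<subseteq> B" and P: "depends_on P A"
  shows "measure_pmf.prob (coins B) {s. P s} = measure_pmf.prob (coins A) {s. P s}"
proof -
  have "measure_pmf.prob (coins (A \<union> (B - A))) {s. P s \<and> True} =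
        measure_pmf.prob (coins A) {s. P s} * measure_pmf.prob (coins (B - A)) {s. True}"
    by (rule prob_coins_conj) (use fin sub P finite_subset in \<open>auto simp: depends_on_def\<close>)
  moreover have "A \<union> (B - A) = B" using sub by auto
  ultimately show ?thesis by simp
qed

lemma prob_coins_conj_subset:
  assumes fin: "finite C" and sub: "A \<subseteq> C" "B \<subseteq> C" and disj: "A \<inter> B = {}"
      and P: "depends_on P A" and Q: "depends_on Q B"
  shows "measure_pmf.prob (coins C) {s. P s \<and> Q s} =
         measure_pmf.prob (coins C) {s. P s} * measure_pmf.prob (coins C) {s. Q s}"
proof -
  have f: "finite A" "finite B" using fin sub finite_subset by auto
  have "depends_on (\<lambda>s. P s \<and> Q s) (A \<union> B)"
    using P Q unfolding depends_on_def by blast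
  then have "measure_pmf.prob (coins C) {s. P s \<and> Q s} =
      measure_pmf.prob (coins (A \<union> B)) {s. P s \<and> Q s}"
    by (intro prob_coins_restrict) (use fin sub in auto)
  also have "\<dots> = measure_pmf.prob (coins A) {s. P s} * measure_pmf.prob (coins B) {s. Q s}"
    by (rule prob_coins_conj[OF f disj P Q])
  finally show ?thesis
    by (simp add: prob_coins_restrict[OF fin sub(1) P] prob_coins_restrict[OF fin sub(2) Q])
qed

text \<open>
  Records are referred to by indices, and \<open>s (i, j)\<close> is bit \<open>j\<close> of record \<open>i\<close>. The list of indices stays
  fixed data while the bits are random, which would not be so for a list of records.
\<close>

definition height_within :: "nat \<Rightarrow> nat \<Rightarrow> 'i list \<Rightarrow> ('i \<times> nat \<Rightarrow> bool) \<Rightarrow> bool" where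
  "height_within h d xs s \<longleftrightarrow> height (dst_at d (map (\<lambda>i j. s (i, j)) xs)) \<le> h"

lemma height_within_simps [simp]:
  "height_within h d [] s"
  "\<not> height_within 0 d (x # xs) s"
  "height_within (Suc h) d (x # xs) s \<longleftrightarrow>
     height_within h (Suc d) (filter (\<lambda>i. \<not> s (i, d)) xs) s \<and>
     height_within h (Suc d) (filter (\<lambda>i. s (i, d)) xs) s"
  by (auto simp: height_within_def filter_map o_def)

text \<open>
  A subtree at level \<open>d\<close> is compared with \<open>h\<close> further levels, which inspects only the bits at positions
  \<open>d, ..., d + h - 1\<close>. This reduces the infinite records to finitely many coins.
\<close>

lemma height_within_depends:
  "depends_on (height_within h d xs) (set xs \<times> {d..<d + h})"
proof (induction h arbitrary: d xs)
  case 0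
  then show ?case by (cases xs) (auto simp: depends_on_def)
next
  case (Suc h)
  show ?case
  proof (cases xs)
    case Nil
    then show ?thesis by (auto simp: depends_on_def)
  next
    case (Cons x ys)
    show ?thesis unfolding depends_on_def
    proof (intro allI impI)
      fix s t :: "'a \<times> nat \<Rightarrow> bool"
      assume eq: "\<forall>p\<in>set xs \<times> {d..<d + Suc h}. s p = t p"
      have f: "filter (\<lambda>i. \<not> s (i, d)) ys = filter (\<lambda>i. \<not> t (i, d)) ys"
              "filter (\<lambda>i. s (i, d)) ys = filter (\<lambda>i. t (i, d)) ys"
        using eq Cons by (auto intro!: filter_cong)
      have "height_within h (Suc d) zs s = height_within h (Suc d) zs t"
        if "set zs \<subseteq> set ys" for zs
        by (rule depends_onD[OF Suc.IH]) (use that eq Cons in auto)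
      then show "height_within (Suc h) d xs s = height_within (Suc h) d xs t"
        by (simp add: Cons f)
    qed
  qed
qed

lemma prob_coins_pattern:
  assumes "finite A" "B \<subseteq> A"
  shows "measure_pmf.prob (coins A) {s. \<forall>x\<in>B. s x = t x} = 1 / 2 ^ card B"
proof -
  have fB: "finite B" using assms finite_subset by auto
  have "measure_pmf.prob (coins A) {s. \<forall>x\<in>B. s x = t x} =
        measure_pmf.prob (coins B) {s. \<forall>x\<in>B. s x = t x}"
    by (rule prob_coins_restrict[OF assms]) (auto simp: depends_on_def)
  also have "\<dots> = measure_pmf.prob (coins B) (Pi B (\<lambda>x. {t x}))"
    by (intro arg_cong[where f = "measure_pmf.prob (coins B)"]) auto
  also have "\<dots> = (\<Prod>x\<in>B. measure_pmf.prob (bernoulli_pmf (1 / 2)) {t x})"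
    by (rule measure_Pi_pmf_Pi[OF fB])
  also have "\<dots> = (\<Prod>x\<in>B. 1 / 2)"
  proof (rule prod.cong)
    fix x show "measure_pmf.prob (bernoulli_pmf (1 / 2)) {t x} = 1 / 2"
      by (cases "t x") (simp_all add: measure_pmf_single)
  qed simp
  finally have "measure_pmf.prob (coins A) {s. \<forall>x\<in>B. s x = t x} = (1 / 2) ^ card B"
    by (simp only: prod_constant)
  then show ?thesis by (simp add: power_divide)
qed

lemma sum_Pow_card:
  fixes f :: "nat \<Rightarrow> real"
  assumes "finite A"
  shows "(\<Sum>J\<in>Pow A. f (card J)) = (\<Sum>j\<le>card A. (card A choose j) * f j)"
proof -
  have "(\<Sum>j\<le>card A. \<Sum>J\<in>{J\<in>Pow A. card J = j}. f (card J)) = (\<Sum>J\<in>Pow A. f (card J))"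
    by (rule sum.group) (use assms in \<open>auto intro: card_mono\<close>)
  moreover have "(\<Sum>J\<in>{J\<in>Pow A. card J = j}. f (card J)) = (card A choose j) * f j" for j
  proof -
    have "(\<Sum>J\<in>{J\<in>Pow A. card J = j}. f (card J)) = (\<Sum>J\<in>{J\<in>Pow A. card J = j}. f j)"
      by (rule sum.cong) auto
    then show ?thesis using n_subsets[OF assms, of j] by simp
  qed
  ultimately show ?thesis by (simp only:)
qed

text \<open>
  Condition on the set \<open>J\<close> of records (apart from the first) that branch to the right. The bits at
  level \<open>d\<close>, the deeper bits of the records in \<open>J\<close> and those of the other records are three disjoint
  groups of coins, so the two subtrees are independent and the induction hypothesis applies to each.
\<close>

lemma prob_height_within:
  assumes "distinct xs" "finite A" "set xs \<times> {d..<d + h} \<subseteq> A"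
  shows "measure_pmf.prob (coins A) {s. height_within h d xs s} = height_cdf h (length xs)"
  using assms
proof (induction h arbitrary: d xs)
  case 0
  then show ?case by (cases xs) auto
next
  case (Suc h)
  show ?case
  proof (cases xs)
    case Nil
    then show ?thesis by simp
  next
    case (Cons x ys)
    let ?N = "length ys" and ?Pr = "measure_pmf.prob (coins A)"
    have dist: "distinct ys" and sub: "set ys \<times> {d..<d + Suc h} \<subseteq> A"
      using Suc.prems Cons by auto
    have cardys: "card (set ys) = ?N" using dist by (rule distinct_card)
    define ones where "ones = (\<lambda>s::'a \<times> nat \<Rightarrow> bool. {i \<in> set ys. s (i, d)})"
    let ?E = "\<lambda>J. {s. (\<forall>p\<in>set ys \<times> {d}. s p = (fst p \<in> J)) \<and>
        (height_within h (Suc d) (filter (\<lambda>i. i \<notin> J) ys) s \<and>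
         height_within h (Suc d) (filter (\<lambda>i. i \<in> J) ys) s)}"
    have decomp: "{s. height_within (Suc h) d xs s} = (\<Union>J\<in>Pow (set ys). ?E J)"
    proof (intro equalityI subsetI)
      fix s assume s: "s \<in> {s. height_within (Suc h) d xs s}"
      have "filter (\<lambda>i. s (i, d)) ys = filter (\<lambda>i. i \<in> ones s) ys"
           "filter (\<lambda>i. \<not> s (i, d)) ys = filter (\<lambda>i. i \<notin> ones s) ys"
        by (auto simp: ones_def intro!: filter_cong)
      then have "s \<in> ?E (ones s)" "ones s \<in> Pow (set ys)"
        using s by (auto simp: Cons) (auto simp: ones_def)
      then show "s \<in> (\<Union>J\<in>Pow (set ys). ?E J)" by blast
    next
      fix s assume "s \<in> (\<Union>J\<in>Pow (set ys). ?E J)"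
      then obtain J where J: "s \<in> ?E J" by blast
      then have "filter (\<lambda>i. s (i, d)) ys = filter (\<lambda>i. i \<in> J) ys"
           "filter (\<lambda>i. \<not> s (i, d)) ys = filter (\<lambda>i. i \<notin> J) ys"
        by (auto intro!: filter_cong)
      then show "s \<in> {s. height_within (Suc h) d xs s}" using J by (simp add: Cons)
    qed
    have disj: "disjoint_family_on ?E (Pow (set ys))"
    unfolding disjoint_family_on_def
    proof (intro ballI impI)
      fix J J' assume J: "J \<in> Pow (set ys)" "J' \<in> Pow (set ys)" "J \<noteq> J'"
      then obtain i where "i \<in> set ys" "(i \<in> J) \<noteq> (i \<in> J')" by blast
      then show "?E J \<inter> ?E J' = {}" by auto
    qed
    have pE: "?Pr (?E J) = 1 / 2 ^ ?N * (height_cdf h (card J) * height_cdf h (?N - card J))"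
      if J: "J \<subseteq> set ys" for J
    proof -
      let ?l = "filter (\<lambda>i. i \<notin> J) ys" and ?r = "filter (\<lambda>i. i \<in> J) ys"
      have lr: "length ?r = card J" "length ?l = ?N - card J"
      proof -
        have "length ?r = card (set ?r)" using dist by (metis distinct_card distinct_filter)
        also have "set ?r = J" using J by auto
        finally show "length ?r = card J" .
        then show "length ?l = ?N - card J"
          using sum_length_filter_compl[of "\<lambda>i. i \<in> J" ys] by simp
      qed
      have dep: "depends_on (\<lambda>s. height_within h (Suc d) ?l s \<and> height_within h (Suc d) ?r s)
             (set ys \<times> {Suc d..<Suc d + h})"
        using depends_on_mono[OF height_within_depends[of h "Suc d" ?l], of "set ys \<times> {Suc d..<Suc d + h}"]
              depends_on_mono[OF height_within_depends[of h "Suc d" ?r], of "set ys \<times> {Suc d..<Suc d + h}"]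
        unfolding depends_on_def by auto
      have "?Pr (?E J) = ?Pr {s. \<forall>p\<in>set ys \<times> {d}. s p = (fst p \<in> J)} *
          ?Pr {s. height_within h (Suc d) ?l s \<and> height_within h (Suc d) ?r s}"
        by (rule prob_coins_conj_subset[OF _ _ _ _ _ dep, where A = "set ys \<times> {d}"])
           (use Suc.prems(2) sub in \<open>auto simp: depends_on_def\<close>)
      also have "?Pr {s. \<forall>p\<in>set ys \<times> {d}. s p = (fst p \<in> J)} = 1 / 2 ^ ?N"
        by (subst prob_coins_pattern) (use Suc.prems(2) sub cardys in auto)
      also have "?Pr {s. height_within h (Suc d) ?l s \<and> height_within h (Suc d) ?r s} =
          ?Pr {s. height_within h (Suc d) ?l s} * ?Pr {s. height_within h (Suc d) ?r s}"
        by (rule prob_coins_conj_subset[OF _ _ _ _ height_within_depends height_within_depends])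
           (use Suc.prems(2) sub in auto)
      also have "?Pr {s. height_within h (Suc d) ?l s} = height_cdf h (?N - card J)"
        by (subst Suc.IH) (use Suc.prems(2) sub dist lr in auto)
      also have "?Pr {s. height_within h (Suc d) ?r s} = height_cdf h (card J)"
        by (subst Suc.IH) (use Suc.prems(2) sub dist lr in auto)
      finally show ?thesis by simp
    qed
    have "?Pr {s. height_within (Suc h) d xs s} = (\<Sum>J\<in>Pow (set ys). ?Pr (?E J))"
      unfolding decomp by (rule measure_pmf.finite_measure_finite_Union) (use disj in auto)
    also have "\<dots> = (\<Sum>J\<in>Pow (set ys). 1 / 2 ^ ?N * (height_cdf h (card J) * height_cdf h (?N - card J)))"
      by (rule sum.cong) (use pE in auto)
    also have "\<dots> = (\<Sum>j\<le>?N. (?N choose j) * (1 / 2 ^ ?N * (height_cdf h j * height_cdf h (?N - j))))"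
      using sum_Pow_card[of "set ys" "\<lambda>c. 1 / 2 ^ ?N * (height_cdf h c * height_cdf h (?N - c))"]
      by (simp add: cardys)
    also have "\<dots> = height_cdf (Suc h) (length xs)"
      by (simp add: Cons mult.assoc)
    finally show ?thesis .
  qed
qed

text \<open>
  Transfer from the given probability space to the product of finitely many coins: both sides are sums
  of \<open>1 / 2 ^ card A\<close> over the bit patterns on \<open>A\<close> that satisfy the event.
\<close>

lemma prob_bits_eq_coins:
  assumes rb: "random_bits M n b" and A: "finite A" "A \<subseteq> {..<n} \<times> UNIV" and P: "depends_on P A"
  shows "{\<omega> \<in> space M. P (\<lambda>(i, j). b i j \<omega>)} \<in> sets M"
    and "\<P>(\<omega> in M. P (\<lambda>(i, j). b i j \<omega>)) = measure_pmf.prob (coins A) {s. P s}"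
proof -
  interpret prob_space M using rb by (simp add: random_bits_def)
  define X where "X = (\<lambda>(i, j). b i j)"
  have ind: "indep_vars (\<lambda>_. count_space UNIV) X ({..<n} \<times> UNIV)"
    using rb by (simp add: random_bits_def X_def)
  have half: "prob {\<omega> \<in> space M. X x \<omega>} = 1 / 2" if "x \<in> {..<n} \<times> UNIV" for x
    using rb that by (auto simp: random_bits_def X_def)
  have rv: "X x \<in> measurable M (count_space UNIV)" if "x \<in> {..<n} \<times> UNIV" for x
    using ind that unfolding indep_vars_def2 by auto
  have bit_set: "{\<omega> \<in> space M. X x \<omega> = v} \<in> events" if "x \<in> {..<n} \<times> UNIV" for x v
    using measurable_sets[OF rv[OF that], of "{v}"]
    by (simp add: vimage_def Int_def conj_commute)
  have bit: "prob {\<omega> \<in> space M. X x \<omega> = v} = 1 / 2" if "x \<in> {..<n} \<times> UNIV" for x v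
  proof (cases v)
    case True
    then show ?thesis using half[OF that] by simp
  next
    case False
    have "prob {\<omega> \<in> space M. \<not> X x \<omega>} = 1 - prob {\<omega> \<in> space M. X x \<omega>}"
      using bit_set[OF that, of True] by (subst prob_neg) auto
    then show ?thesis using False half[OF that] by simp
  qed
  define T where "T = PiE_dflt A False (\<lambda>_. UNIV :: bool set)"
  have finT: "finite T" unfolding T_def using A by (intro finite_PiE_dflt) auto
  define cyl where "cyl = (\<lambda>t. {\<omega> \<in> space M. \<forall>x\<in>A. X x \<omega> = t x})"
  have cyl_sets: "cyl t \<in> events" for t
    unfolding cyl_def using A bit_set by (intro sets.sets_Collect_finite_All) auto
  have cyl_prob: "prob (cyl t) = 1 / 2 ^ card A" for t
  proof (cases "A = {}")
    case True
    then show ?thesis by (simp add: cyl_def prob_space)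
  next
    case False
    have "prob (cyl t) = prob (\<Inter>x\<in>A. X x -` {t x} \<inter> space M)"
      using False by (intro arg_cong[where f = prob]) (auto simp: cyl_def)
    also have "\<dots> = (\<Prod>x\<in>A. prob (X x -` {t x} \<inter> space M))"
      by (rule indep_varsD[OF ind False A]) simp
    also have "\<dots> = (\<Prod>x\<in>A. 1 / 2)"
    proof (rule prod.cong)
      fix x assume "x \<in> A"
      moreover have "X x -` {t x} \<inter> space M = {\<omega> \<in> space M. X x \<omega> = t x}" by auto
      ultimately show "prob (X x -` {t x} \<inter> space M) = 1 / 2"
        using bit[of x "t x"] A by auto
    qed simp
    finally show ?thesis by (simp add: power_divide)
  qed
  have Xeq: "(\<lambda>(i, j). b i j \<omega>) = (\<lambda>x. X x \<omega>)" for \<omega>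
    by (auto simp: X_def)
  have decomp: "{\<omega> \<in> space M. P (\<lambda>(i, j). b i j \<omega>)} = (\<Union>t\<in>{t \<in> T. P t}. cyl t)"
    unfolding Xeq
  proof (intro equalityI subsetI)
    fix \<omega> assume w: "\<omega> \<in> {\<omega> \<in> space M. P (\<lambda>x. X x \<omega>)}"
    define t where "t = (\<lambda>x. if x \<in> A then X x \<omega> else False)"
    have "P t = P (\<lambda>x. X x \<omega>)" by (rule depends_onD[OF P]) (auto simp: t_def)
    then have "t \<in> {t \<in> T. P t}" "\<omega> \<in> cyl t"
      using w by (auto simp: t_def T_def PiE_dflt_def cyl_def)
    then show "\<omega> \<in> (\<Union>t\<in>{t \<in> T. P t}. cyl t)" by blast
  next
    fix \<omega> assume "\<omega> \<in> (\<Union>t\<in>{t \<in> T. P t}. cyl t)"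
    then obtain t where t: "P t" "\<omega> \<in> cyl t" by auto
    have "P t = P (\<lambda>x. X x \<omega>)" by (rule depends_onD[OF P]) (use t in \<open>auto simp: cyl_def\<close>)
    then show "\<omega> \<in> {\<omega> \<in> space M. P (\<lambda>x. X x \<omega>)}" using t by (auto simp: cyl_def)
  qed
  show "{\<omega> \<in> space M. P (\<lambda>(i, j). b i j \<omega>)} \<in> sets M"
    unfolding decomp using finT cyl_sets by (intro sets.finite_UN) auto
  have disj: "disjoint_family_on cyl {t \<in> T. P t}"
  unfolding disjoint_family_on_def
    proof (intro ballI impI)
    fix t u assume tu: "t \<in> {t \<in> T. P t}" "u \<in> {t \<in> T. P t}" "t \<noteq> u"
    then obtain x where x: "t x \<noteq> u x" by blast
    have "x \<in> A"
    proof (rule ccontr)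
      assume "x \<notin> A"
      then have "t x = False" "u x = False" using tu unfolding T_def PiE_dflt_def by blast+
      then show False using x by simp
    qed
    then show "cyl t \<inter> cyl u = {}" using x by (auto simp: cyl_def)
  qed
  have "\<P>(\<omega> in M. P (\<lambda>(i, j). b i j \<omega>)) = (\<Sum>t\<in>{t \<in> T. P t}. prob (cyl t))"
    unfolding decomp by (rule finite_measure_finite_Union) (use finT cyl_sets disj in auto)
  also have "\<dots> = (\<Sum>t\<in>{t \<in> T. P t}. pmf (coins A) t)"
  proof (rule sum.cong)
    fix t assume t: "t \<in> {t \<in> T. P t}"
    have "pmf (bernoulli_pmf (1 / 2)) v = 1 / 2" for v
      by (cases v) auto
    then show "prob (cyl t) = pmf (coins A) t"
      using t A by (subst pmf_Pi') (auto simp: cyl_prob T_def PiE_dflt_def power_divide)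
  qed simp
  also have "\<dots> = measure_pmf.prob (coins A) {t \<in> T. P t}"
    using finT by (simp add: measure_measure_pmf_finite)
  also have "\<dots> = measure_pmf.prob (coins A) {s. P s}"
    using A by (intro measure_prob_cong_0) (auto simp: T_def PiE_dflt_def intro!: pmf_Pi_outside)
  finally show "\<P>(\<omega> in M. P (\<lambda>(i, j). b i j \<omega>)) = measure_pmf.prob (coins A) {s. P s}" .
qed

lemma prob_dst_height_le:
  assumes rb: "random_bits M n b"
  shows "{\<omega> \<in> space M. dst_height n b \<omega> \<le> h} \<in> sets M"
    and "\<P>(\<omega> in M. dst_height n b \<omega> \<le> h) = height_cdf h n"
proof -
  let ?A = "{..<n} \<times> {0..<0 + h}"
  have eq: "dst_height n b \<omega> \<le> h \<longleftrightarrow> height_within h 0 [0..<n] (\<lambda>(i, j). b i j \<omega>)" for \<omega>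
    by (simp add: dst_height_def ext_height_eq_height dst_def height_within_def)
  have dep: "depends_on (height_within h 0 [0..<n]) ?A"
    using height_within_depends[of h 0 "[0..<n]"] by (simp add: lessThan_atLeast0)
  have A: "finite ?A" "?A \<subseteq> {..<n} \<times> UNIV" by auto
  show "{\<omega> \<in> space M. dst_height n b \<omega> \<le> h} \<in> sets M"
    unfolding eq by (rule prob_bits_eq_coins[OF rb A dep])
  show "\<P>(\<omega> in M. dst_height n b \<omega> \<le> h) = height_cdf h n"
    unfolding eq prob_bits_eq_coins(2)[OF rb A dep]
    by (subst prob_height_within) (use A in \<open>auto simp: lessThan_atLeast0\<close>)
qed

section \<open>Upper tail: counting chains of records\<close>

text \<open>
  A union bound over the two subtrees of the root, which have the same law.
\<close>

lemma height_tail_step: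
  "1 - height_cdf (Suc h) (Suc n) \<le> 2 * (\<Sum>j\<le>n. (n choose j) / 2 ^ n * (1 - height_cdf h j))"
proof -
  let ?w = "\<lambda>j. (n choose j) / 2 ^ n :: real" and ?q = "\<lambda>j. 1 - height_cdf h j"
  have sym: "(\<Sum>j\<le>n. ?w j * ?q (n - j)) = (\<Sum>j\<le>n. ?w j * ?q j)"
    by (rule sum.reindex_bij_witness[of _ "\<lambda>j. n - j" "\<lambda>j. n - j"])
       (auto simp: binomial_symmetric[symmetric])
  have "1 - height_cdf (Suc h) (Suc n)
      = (\<Sum>j\<le>n. ?w j) - (\<Sum>j\<le>n. ?w j * height_cdf h j * height_cdf h (n - j))"
    by (simp only: binomial_average_one height_cdf.simps)
  also have "\<dots> = (\<Sum>j\<le>n. ?w j * (1 - height_cdf h j * height_cdf h (n - j)))"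
    by (simp only: sum_subtractf[symmetric]) (simp add: algebra_simps)
  also have "\<dots> \<le> (\<Sum>j\<le>n. ?w j * (?q j + ?q (n - j)))"
  proof (intro sum_mono mult_left_mono)
    fix j
    have "0 \<le> ?q j * ?q (n - j)" using height_cdf_le_1 by (intro mult_nonneg_nonneg) auto
    then show "1 - height_cdf h j * height_cdf h (n - j) \<le> ?q j + ?q (n - j)"
      by (simp add: algebra_simps)
  qed auto
  also have "\<dots> = 2 * (\<Sum>j\<le>n. ?w j * ?q j)"
    using sym by (simp only: distrib_left sum.distrib mult_2)
  finally show ?thesis .
qed

text \<open>
  The factorial moments of the binomial distribution with success probability \<open>1 / 2\<close>: each
  \<open>m\<close>-subset of the records goes to one given side with probability \<open>1 / 2 ^ m\<close>.
\<close>

lemma binomial_average_choose: "(\<Sum>j\<le>n. (n choose j) / 2 ^ n * (j choose m)) = (n choose m) / (2 ^ m :: real)"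
proof (cases "m \<le> n")
  case True
  have "(\<Sum>j\<le>n. (n choose j) * (j choose m)) = (\<Sum>j=m..n. (n choose j) * (j choose m))"
    by (rule sum.mono_neutral_right) auto
  also have "\<dots> = (\<Sum>j=m..n. (n choose m) * ((n - m) choose (j - m)))"
    by (rule sum.cong) (auto simp: choose_mult)
  also have "\<dots> = (n choose m) * (\<Sum>j\<le>n - m. (n - m) choose j)"
    unfolding sum_distrib_left
    by (rule sum.reindex_bij_witness[of _ "\<lambda>j. j + m" "\<lambda>j. j - m"]) (use True in auto)
  finally have "(\<Sum>j\<le>n. (n choose j) * (j choose m)) = (n choose m) * 2 ^ (n - m)"
    by (simp add: choose_row_sum)
  then have "(\<Sum>j\<le>n. real (n choose j) * real (j choose m)) = (n choose m) * 2 ^ (n - m)"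
    by (metis (mono_tags, lifting) of_nat_mult of_nat_numeral of_nat_power of_nat_sum sum.cong)
  moreover have "(2 :: real) ^ n = 2 ^ (n - m) * 2 ^ m"
    using True by (simp add: power_add[symmetric])
  ultimately show ?thesis
    by (simp add: sum_divide_distrib[symmetric])
qed (auto intro!: sum.neutral simp: binomial_eq_0)

text \<open>
  If the height exceeds \<open>h\<close>, then \<open>h + 1\<close> records lie on one path from the root, the one at level
  \<open>j\<close> beginning with the first \<open>j\<close> bits of a string of length \<open>h\<close> that describes the path. The right-hand side is the expected
  number of such chains; passing from one level to the next, the choice of the root is paid for by
  \<open>n choose (h + 1) \<le> Suc n choose (h + 2)\<close>.
\<close>

lemma height_tail_full_chain:
  "1 - height_cdf h n \<le> 2 powr (real h - real h * (real h + 1) / 2) * (n choose (h + 1))"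
proof (induction h arbitrary: n)
  case 0
  show ?case by (cases n) auto
next
  case (Suc h)
  let ?a = "2 powr (real h - real h * (real h + 1) / 2) :: real"
  show ?case
  proof (cases n)
    case (Suc m)
    have "1 - height_cdf (Suc h) n \<le> 2 * (\<Sum>j\<le>m. (m choose j) / 2 ^ m * (1 - height_cdf h j))"
      unfolding Suc by (rule height_tail_step)
    also have "\<dots> \<le> 2 * (\<Sum>j\<le>m. (m choose j) / 2 ^ m * (?a * (j choose (h + 1))))"
      by (intro mult_left_mono sum_mono Suc.IH) auto
    also have "\<dots> = 2 * ?a * (\<Sum>j\<le>m. (m choose j) / 2 ^ m * (j choose (h + 1)))"
      unfolding sum_distrib_left by (intro sum.cong) (simp_all only: mult_ac)
    also have "\<dots> = 2 * ?a / 2 ^ (h + 1) * (m choose (h + 1))"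
      by (simp only: binomial_average_choose) simp
    also have "2 * ?a / 2 ^ (h + 1) = 2 powr (1 + (real h - real h * (real h + 1) / 2) - real (h + 1))"
      by (simp only: powr_diff powr_add powr_one) (simp add: powr_realpow powr_add)
    also have "1 + (real h - real h * (real h + 1) / 2) - real (h + 1) = real (Suc h) - real (Suc h) * (real (Suc h) + 1) / 2"
      by (simp add: field_simps)
    also have "2 powr (real (Suc h) - real (Suc h) * (real (Suc h) + 1) / 2) * (m choose (h + 1))
       \<le> 2 powr (real (Suc h) - real (Suc h) * (real (Suc h) + 1) / 2) * (n choose (Suc h + 1))"
      by (intro mult_left_mono) (auto simp: Suc)
    finally show ?thesis .
  qed auto
qed

text \<open>
  The same count for the last \<open>f + 1\<close> nodes of a path of length \<open>f + g\<close>. Near the root almost all nodes are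
  filled, and counting full chains there would overestimate the probability; ignoring the first \<open>g\<close>
  levels costs only the number \<open>2 ^ g\<close> of subtrees.
\<close>

lemma height_tail_partial_chain:
  "1 - height_cdf (f + g) n \<le> 2 powr (real f - real f * (real f + 1) / 2 - real f * real g) * (n choose (f + 1))"
proof (induction g arbitrary: n)
  case 0
  show ?case using height_tail_full_chain[of f n] by simp
next
  case (Suc g)
  let ?a = "2 powr (real f - real f * (real f + 1) / 2 - real f * real g) :: real"
  show ?case
  proof (cases n)
    case (Suc m)
    have "1 - height_cdf (f + Suc g) n \<le> 2 * (\<Sum>j\<le>m. (m choose j) / 2 ^ m * (1 - height_cdf (f + g) j))"
      unfolding Suc add_Suc_right by (rule height_tail_step)
    also have "\<dots> \<le> 2 * (\<Sum>j\<le>m. (m choose j) / 2 ^ m * (?a * (j choose (f + 1))))"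
      by (intro mult_left_mono sum_mono Suc.IH) auto
    also have "\<dots> = 2 * ?a * (\<Sum>j\<le>m. (m choose j) / 2 ^ m * (j choose (f + 1)))"
      unfolding sum_distrib_left by (intro sum.cong) (simp_all only: mult_ac)
    also have "\<dots> = 2 * ?a / 2 ^ (f + 1) * (m choose (f + 1))"
      by (simp only: binomial_average_choose) simp
    also have "2 * ?a / 2 ^ (f + 1) = 2 powr (1 + (real f - real f * (real f + 1) / 2 - real f * real g) - real (f + 1))"
      by (simp only: powr_diff powr_add powr_one) (simp add: powr_realpow powr_add)
    also have "1 + (real f - real f * (real f + 1) / 2 - real f * real g) - real (f + 1) = real f - real f * (real f + 1) / 2 - real f * real (Suc g)"
      by (simp add: field_simps)
    also have "2 powr (real f - real f * (real f + 1) / 2 - real f * real (Suc g)) * (m choose (f + 1))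
       \<le> 2 powr (real f - real f * (real f + 1) / 2 - real f * real (Suc g)) * (n choose (f + 1))"
      by (intro mult_left_mono) (auto simp: Suc)
    finally show ?thesis .
  qed auto
qed

section \<open>Poissonization\<close>

text \<open>
  The exponential generating function of \<open>height_cdf h\<close>. It is a polynomial, because a tree of height \<open>h\<close>
  cannot hold \<open>2 ^ h\<close> records, so neither convergence nor termwise differentiation is an issue.
\<close>

definition gen_poly :: "nat \<Rightarrow> real poly" where
  "gen_poly h = (\<Sum>n<2 ^ h. monom (height_cdf h n / fact n) n)"

definition gen :: "nat \<Rightarrow> real \<Rightarrow> real" where
  "gen h z = poly (gen_poly h) z"

text \<open>
  The probability that a tree with a Poisson distributed number of records of mean \<open>z\<close> has height at
  most \<open>h\<close>.
\<close>

definition poisson_cdf :: "nat \<Rightarrow> real \<Rightarrow> real" where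
  "poisson_cdf h z = exp (- z) * gen h z"

lemma coeff_gen_poly: "coeff (gen_poly h) n = height_cdf h n / fact n"
proof -
  have "coeff (gen_poly h) n = (\<Sum>m<2 ^ h. if m = n then height_cdf h m / fact m else 0)"
    by (simp add: gen_poly_def coeff_sum)
  also have "\<dots> = height_cdf h n / fact n"
    by (simp add: height_cdf_eq_0)
  finally show ?thesis .
qed

text \<open>
  The binomial convolution in the recurrence is the product of exponential generating functions, the
  weight \<open>1 / 2 ^ n\<close> halves the argument, and the differentiation removes the record in the root.
\<close>

lemma pderiv_gen_poly:
  "pderiv (gen_poly (Suc h)) = pcompose (gen_poly h) [:0, 1 / 2:] * pcompose (gen_poly h) [:0, 1 / 2:]"
proof (rule poly_eqI)
  fix n
  have "coeff (pderiv (gen_poly (Suc h))) n = height_cdf (Suc h) (Suc n) / fact n"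
    by (simp add: coeff_pderiv coeff_gen_poly del: height_cdf.simps of_nat_Suc)
  also have "\<dots> = (\<Sum>j\<le>n. (1 / 2) ^ j * (height_cdf h j / fact j) *
      ((1 / 2) ^ (n - j) * (height_cdf h (n - j) / fact (n - j))))"
    unfolding height_cdf.simps sum_divide_distrib
  proof (rule sum.cong)
    fix j assume "j \<in> {..n}"
    then have j: "j \<le> n" by simp
    have "(1 / 2) ^ j * (1 / 2) ^ (n - j) = (1 / 2 :: real) ^ n"
      using j by (simp add: power_add[symmetric])
    then show "(n choose j) / 2 ^ n * height_cdf h j * height_cdf h (n - j) / fact n =
       (1 / 2) ^ j * (height_cdf h j / fact j) * ((1 / 2) ^ (n - j) * (height_cdf h (n - j) / fact (n - j)))"
      using j by (simp add: binomial_fact power_divide field_simps)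
  qed simp
  also have "\<dots> = coeff (pcompose (gen_poly h) [:0, 1 / 2:] * pcompose (gen_poly h) [:0, 1 / 2:]) n"
    by (simp add: coeff_mult coeff_pcompose_linear coeff_gen_poly)
  finally show "coeff (pderiv (gen_poly (Suc h))) n = \<dots>" .
qed

lemma gen_0 [simp]: "gen 0 z = 1"
  by (simp add: gen_def gen_poly_def)

lemma gen_at_0 [simp]: "gen h 0 = 1"
  by (simp add: gen_def poly_0_coeff_0 coeff_gen_poly)

lemma gen_deriv:
  "(gen (Suc h) has_real_derivative (gen h (z / 2))\<^sup>2) (at z within S)"
proof -
  have "((\<lambda>z. poly (gen_poly (Suc h)) z) has_real_derivative poly (pderiv (gen_poly (Suc h))) z) (at z within S)"
    by (rule has_field_derivative_at_within[OF poly_DERIV])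
  also have "poly (pderiv (gen_poly (Suc h))) z = (gen h (z / 2))\<^sup>2"
    by (simp add: pderiv_gen_poly poly_pcompose gen_def power2_eq_square mult.commute)
  finally show ?thesis by (simp add: gen_def[abs_def])
qed

lemma le_of_nonneg_deriv:
  fixes \<phi> :: "real \<Rightarrow> real"
  assumes "a \<le> b" "\<And>u. a \<le> u \<Longrightarrow> u \<le> b \<Longrightarrow> (\<phi> has_real_derivative \<phi>' u) (at u)"
      "\<And>u. a \<le> u \<Longrightarrow> u \<le> b \<Longrightarrow> 0 \<le> \<phi>' u"
  shows "\<phi> a \<le> \<phi> b"
  by (rule DERIV_nonneg_imp_nondecreasing) (use assms in auto)

lemma gen_ge_1: "0 \<le> z \<Longrightarrow> 1 \<le> gen h z"
proof (cases h)
  case (Suc h')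
  assume "0 \<le> z"
  then have "gen h 0 \<le> gen h z"
    unfolding Suc by (rule le_of_nonneg_deriv[OF _ gen_deriv]) auto
  then show ?thesis by simp
qed simp

lemma gen_le_exp: "0 \<le> z \<Longrightarrow> gen h z \<le> exp z"
proof (induction h arbitrary: z)
  case (Suc h)
  have "exp 0 - gen (Suc h) 0 \<le> exp z - gen (Suc h) z"
  proof (rule le_of_nonneg_deriv[OF Suc.prems])
    fix u :: real assume u: "0 \<le> u"
    show "((\<lambda>z. exp z - gen (Suc h) z) has_real_derivative exp u - (gen h (u / 2))\<^sup>2) (at u)"
      by (auto intro!: derivative_eq_intros gen_deriv)
    have "(gen h (u / 2))\<^sup>2 \<le> (exp (u / 2))\<^sup>2"
      using u gen_ge_1[of "u / 2" h] by (intro power_mono Suc.IH) auto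
    also have "\<dots> = exp u" by (simp add: exp_double[symmetric])
    finally show "0 \<le> exp u - (gen h (u / 2))\<^sup>2" by simp
  qed
  then show ?case by simp
qed simp

lemma poisson_cdf_nonneg: "0 \<le> z \<Longrightarrow> 0 \<le> poisson_cdf h z"
  using gen_ge_1[of z h] by (simp add: poisson_cdf_def)

lemma poisson_cdf_le_1: "0 \<le> z \<Longrightarrow> poisson_cdf h z \<le> 1"
  using gen_le_exp[of z h] by (simp add: poisson_cdf_def exp_minus field_simps)

lemma gen_sq_eq: "(gen h (u / 2))\<^sup>2 = exp u * (poisson_cdf h (u / 2))\<^sup>2"
proof -
  have "exp u = (exp (u / 2))\<^sup>2" by (simp add: exp_double[symmetric])
  moreover have "exp (u / 2) * poisson_cdf h (u / 2) = gen h (u / 2)"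
    by (simp add: poisson_cdf_def mult.assoc[symmetric] exp_minus_inverse)
  ultimately show ?thesis by (simp only: power_mult_distrib[symmetric])
qed

text \<open>
  Bounds for \<open>poisson_cdf\<close> on the level above arise by comparing \<open>gen (Suc h)\<close> with a multiple of \<open>exp\<close>:
  the sign of this derivative compares \<open>poisson_cdf h\<close> with a constant.
\<close>

lemma gen_minus_exp_deriv:
  "((\<lambda>u. gen (Suc h) u - exp u * c) has_real_derivative
     exp u * ((poisson_cdf h (u / 2))\<^sup>2 - c)) (at u)"
  by (auto intro!: derivative_eq_intros gen_deriv simp: gen_sq_eq algebra_simps)

text \<open>
  More records make the tree higher. In terms of the differential equation, \<open>poisson_cdf (Suc h)\<close> has
  derivative \<open>(poisson_cdf h (z / 2))\<^sup>2 - poisson_cdf (Suc h) z\<close>, and monotonicity on level \<open>h\<close> makes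
  this non-positive.
\<close>

lemma poisson_cdf_antimono: "0 \<le> x \<Longrightarrow> x \<le> y \<Longrightarrow> poisson_cdf h y \<le> poisson_cdf h x"
proof (induction h arbitrary: x y)
  case 0
  then show ?case by (simp add: poisson_cdf_def)
next
  case (Suc h)
  have ge: "(poisson_cdf h (z / 2))\<^sup>2 \<le> poisson_cdf (Suc h) z" if z: "0 \<le> z" for z
  proof -
    let ?c = "(poisson_cdf h (z / 2))\<^sup>2"
    have "gen (Suc h) 0 - exp 0 * ?c \<le> gen (Suc h) z - exp z * ?c"
    proof (rule le_of_nonneg_deriv[OF z gen_minus_exp_deriv])
      fix u assume u: "0 \<le> u" "u \<le> z"
      have "?c \<le> (poisson_cdf h (u / 2))\<^sup>2"
        using u z by (intro power_mono Suc.IH poisson_cdf_nonneg) auto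
      then show "0 \<le> exp u * ((poisson_cdf h (u / 2))\<^sup>2 - ?c)" by simp
    qed
    moreover have "?c \<le> 1"
      using z by (intro power_le_one poisson_cdf_nonneg poisson_cdf_le_1) auto
    ultimately have "exp z * ?c \<le> gen (Suc h) z" by simp
    then have "exp (- z) * (exp z * ?c) \<le> exp (- z) * gen (Suc h) z"
      by (intro mult_left_mono) auto
    then show ?thesis by (simp add: poisson_cdf_def mult.assoc[symmetric] exp_minus_inverse mult.commute[of "exp (- z)"])
  qed
  have "- poisson_cdf (Suc h) x \<le> - poisson_cdf (Suc h) y"
  proof (rule le_of_nonneg_deriv[OF Suc.prems(2)])
    fix u assume u: "x \<le> u"
    have "((\<lambda>z. - (exp (- z) * gen (Suc h) z)) has_real_derivative
        poisson_cdf (Suc h) u - (poisson_cdf h (u / 2))\<^sup>2) (at u)"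
      by (auto intro!: derivative_eq_intros gen_deriv simp: gen_sq_eq poisson_cdf_def[of "Suc h"] exp_minus)
    then show "((\<lambda>z. - poisson_cdf (Suc h) z) has_real_derivative
        poisson_cdf (Suc h) u - (poisson_cdf h (u / 2))\<^sup>2) (at u)"
      by (simp add: poisson_cdf_def)
    show "0 \<le> poisson_cdf (Suc h) u - (poisson_cdf h (u / 2))\<^sup>2"
      using ge[of u] u Suc.prems by simp
  qed
  then show ?case by simp
qed

text \<open>
  Think of the records as arriving in time. Unless nothing arrives during the first \<open>w\<close> time units,
  which has probability \<open>exp (- w)\<close>, the root is filled with at least \<open>2 * z\<close> time units left, and both
  subtrees receive a Poisson number of records of mean at least \<open>z\<close>.
\<close>

lemma poisson_cdf_step:
  assumes z: "0 \<le> z" and w: "0 \<le> w"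
  shows "poisson_cdf (Suc h) (2 * z + w) \<le> exp (- w) + (1 - exp (- w)) * (poisson_cdf h z)\<^sup>2"
proof -
  let ?c = "(poisson_cdf h z)\<^sup>2"
  have "- (gen (Suc h) (2 * z) - exp (2 * z) * ?c) \<le> - (gen (Suc h) (2 * z + w) - exp (2 * z + w) * ?c)"
  proof (rule le_of_nonneg_deriv[OF _ DERIV_minus[OF gen_minus_exp_deriv]])
    fix u assume u: "2 * z \<le> u" "u \<le> 2 * z + w"
    have "(poisson_cdf h (u / 2))\<^sup>2 \<le> ?c"
      using u z by (intro power_mono poisson_cdf_antimono poisson_cdf_nonneg) auto
    then show "0 \<le> - (exp u * ((poisson_cdf h (u / 2))\<^sup>2 - ?c))"
      by (simp add: mult_le_0_iff)
  qed (use w in auto)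
  moreover have "gen (Suc h) (2 * z) \<le> exp (2 * z)" using z by (intro gen_le_exp) auto
  ultimately have "gen (Suc h) (2 * z + w) \<le> exp (2 * z) + (exp (2 * z + w) - exp (2 * z)) * ?c"
    by (simp add: algebra_simps)
  then have "exp (- (2 * z + w)) * gen (Suc h) (2 * z + w) \<le>
     exp (- (2 * z + w)) * (exp (2 * z) + (exp (2 * z + w) - exp (2 * z)) * ?c)"
    by (intro mult_left_mono) auto
  also have "\<dots> = exp (- w) + (1 - exp (- w)) * ?c"
  proof -
    have "exp (- (2 * z + w)) * exp (2 * z) = exp (- w)"
         "exp (- (2 * z + w)) * exp (2 * z + w) = 1"
      by (simp_all only: exp_add[symmetric]) simp_all
    then show ?thesis by (simp only: distrib_left right_diff_distrib left_diff_distrib mult.assoc[symmetric])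
  qed
  finally show ?thesis by (simp add: poisson_cdf_def)
qed

section \<open>Stirling bounds for factorials\<close>

lemma fact_lower: "(n / exp 1) ^ n \<le> (fact n :: real)"
proof (induction n)
  case (Suc n)
  show ?case
  proof (cases "n = 0")
    case False
    have "real (Suc n) ^ n = (1 + 1 / n) ^ n * real n ^ n"
      using False by (simp add: power_mult_distrib[symmetric] field_simps)
    also have "(1 + 1 / n) ^ n \<le> exp (1 / n) ^ n"
      by (intro power_mono exp_ge_add_one_self) auto
    also have "exp (1 / n) ^ n = exp 1" using False by (simp add: exp_of_nat_mult[symmetric])
    finally have *: "real (Suc n) ^ n \<le> exp 1 * real n ^ n" by (simp add: mult_right_mono)
    have "(Suc n / exp 1) ^ Suc n = Suc n * (real (Suc n) ^ n / (exp 1 * exp 1 ^ n))"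
      by (simp add: power_divide)
    also have "\<dots> \<le> Suc n * (exp 1 * real n ^ n / (exp 1 * exp 1 ^ n))"
      by (intro mult_left_mono divide_right_mono *) auto
    also have "\<dots> = Suc n * (n / exp 1) ^ n" by (simp add: power_divide)
    also have "\<dots> \<le> Suc n * (fact n :: real)" by (intro mult_left_mono Suc.IH) auto
    finally show ?thesis by simp
  qed simp
qed simp

lemma fact_upper: "1 \<le> n \<Longrightarrow> (fact n :: real) \<le> exp 1 * n * (n / exp 1) ^ n"
proof (induction n rule: dec_induct)
  case (step n)
  have "1 / Suc n \<le> ln (1 + 1 / n)"
  proof -
    have "ln (n / Suc n :: real) \<le> n / Suc n - 1" using step by (intro ln_le_minus_one) auto
    also have "\<dots> = - (1 / Suc n)" by (simp add: field_simps)
    also have "ln (n / Suc n :: real) = - ln (1 + 1 / n)"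
      using step by (simp add: ln_div field_simps)
    finally show ?thesis by simp
  qed
  then have "exp (1 / Suc n) \<le> 1 + 1 / n"
    using step by (metis add_pos_nonneg exp_le_cancel_iff exp_ln of_nat_0_le_iff zero_le_divide_1_iff zero_less_one)
  then have "exp (1 / Suc n) ^ Suc n \<le> (1 + 1 / n) ^ Suc n"
    by (intro power_mono) auto
  moreover have "exp (1 / Suc n) ^ Suc n = exp 1"
    by (simp only: exp_of_nat_mult[symmetric]) simp
  ultimately have *: "exp 1 * real n ^ Suc n \<le> real (Suc n) ^ Suc n"
    using step by (simp add: power_divide field_simps)
  have "fact (Suc n) = Suc n * (fact n :: real)" by simp
  also have "\<dots> \<le> Suc n * (exp 1 * n * (n / exp 1) ^ n)"
    by (intro mult_left_mono step.IH) auto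
  also have "\<dots> = Suc n * (exp 1 * real n ^ Suc n) / exp 1 ^ n"
    by (simp add: power_divide)
  also have "\<dots> \<le> Suc n * (real (Suc n) ^ Suc n) / exp 1 ^ n"
    by (intro divide_right_mono mult_left_mono *) auto
  also have "\<dots> = exp 1 * Suc n * (Suc n / exp 1) ^ Suc n"
    by (simp add: power_divide)
  finally show ?case .
qed simp

lemma powr_inverse_ln2: "(2 :: real) powr (c / ln 2) = exp c"
  by (simp add: powr_def)

lemma fact_le_powr:
  assumes "1 \<le> n"
  shows "fact n \<le> 2 powr (1 / ln 2 + log 2 n + n * (log 2 n - 1 / ln 2))"
proof -
  have e: "2 powr (1 / ln 2) = exp (1 :: real)" by (rule powr_inverse_ln2)
  have "2 powr (1 / ln 2 + log 2 n + n * (log 2 n - 1 / ln 2)) = 2 powr (1 / ln 2 + log 2 n) * (2 powr (log 2 n - 1 / ln 2)) powr n"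
    by (simp only: powr_add powr_powr mult.commute)
  also have "2 powr (log 2 n - 1 / ln 2) = n / exp 1"
    using assms by (simp only: powr_diff e) simp
  also have "2 powr (1 / ln 2 + log 2 n) = exp 1 * n"
    using assms by (simp only: powr_add e) simp
  also have "(n / exp 1) powr n = (n / exp 1 :: real) ^ n"
    using assms by (simp add: powr_realpow)
  finally show ?thesis using fact_upper[OF assms] by simp
qed

section \<open>Lower tail: independent subtrees with Poisson sizes\<close>

text \<open>
  The left-hand side is the first non-zero term of the power series of the right-hand side: it accounts for
  \<open>i + 1\<close> records that form one path. In the induction, the difference of squares
  \<open>exp u - (gen i (u / 2))\<^sup>2\<close> gains the full factor 2, as both \<open>exp\<close> and \<open>gen\<close> are at least 1. Losing
  a factor 2 per level here would be too much: it would amount to a shift of the threshold by one level.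
\<close>

lemma gen_gap:
  assumes "0 \<le> u"
  shows "2 powr (real i - real i * (real i + 1) / 2) * u ^ (i + 1) / fact (i + 1) \<le> exp u - gen i u"
  using assms
proof (induction i arbitrary: u)
  case 0
  then show ?case using exp_ge_add_one_self[of u] by (simp, linarith)
next
  case (Suc i)
  define K where "K = (\<lambda>i. 2 powr (real i - real i * (real i + 1) / 2) / fact (i + 1) :: real)"
  have K_Suc: "K (Suc i) * (i + 2) = 2 * (K i / 2 ^ (i + 1))"
  proof -
    have "2 powr (real (Suc i) - real (Suc i) * (real (Suc i) + 1) / 2) = 2 powr (1 + (real i - real i * (real i + 1) / 2) - real (i + 1))"
      by (intro arg_cong[where f = "\<lambda>x. 2 powr x"]) (simp add: field_simps)
    also have "\<dots> = 2 * 2 powr (real i - real i * (real i + 1) / 2) / 2 ^ (i + 1)"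
      by (simp only: powr_diff powr_add powr_one) (simp add: powr_realpow powr_add)
    finally have p: "2 powr (real (Suc i) - real (Suc i) * (real (Suc i) + 1) / 2) =
       2 * 2 powr (real i - real i * (real i + 1) / 2) / 2 ^ (i + 1)" .
    have f: "(fact (Suc i + 1) :: real) = (real i + 2) * fact (i + 1)"
      by (simp add: algebra_simps)
    have "a / ((real i + 2) * F) * (real i + 2) = a / F" for a F :: real
      by (simp add: add_eq_0_iff)
    then show ?thesis unfolding K_def p f by (simp only: of_nat_add of_nat_numeral) simp
  qed
  have "exp 0 - gen (Suc i) 0 - K (Suc i) * 0 ^ (i + 2) \<le> exp u - gen (Suc i) u - K (Suc i) * u ^ (i + 2)"
  proof (rule le_of_nonneg_deriv[OF Suc.prems])
    fix v :: real assume v: "0 \<le> v"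
    show "((\<lambda>v. exp v - gen (Suc i) v - K (Suc i) * v ^ (i + 2)) has_real_derivative
        exp v - (gen i (v / 2))\<^sup>2 - K (Suc i) * (i + 2) * v ^ (i + 1)) (at v)"
    proof (intro derivative_intros gen_deriv DERIV_exp)
      have "((\<lambda>z. K (Suc i) * z ^ (i + 2)) has_real_derivative
          K (Suc i) * (real (i + 2) * v ^ (i + 2 - Suc 0))) (at v)"
        by (intro DERIV_cmult DERIV_pow)
      then show "((\<lambda>z. K (Suc i) * z ^ (i + 2)) has_real_derivative
          K (Suc i) * (i + 2) * v ^ (i + 1)) (at v)"
        by (simp only: mult.assoc) simp
    qed
    have "K (Suc i) * (i + 2) * v ^ (i + 1) = (K i * (v / 2) ^ (i + 1)) * 2"
      unfolding K_Suc by (simp add: power_divide)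
    also have "\<dots> \<le> (exp (v / 2) - gen i (v / 2)) * (exp (v / 2) + gen i (v / 2))"
    proof (intro mult_mono)
      show "K i * (v / 2) ^ (i + 1) \<le> exp (v / 2) - gen i (v / 2)"
        using Suc.IH[of "v / 2"] v by (simp only: K_def times_divide_eq_left)
      show "2 \<le> exp (v / 2) + gen i (v / 2)"
        using gen_ge_1[of "v / 2" i] one_le_exp_iff[of "v / 2"] v by linarith
      show "0 \<le> exp (v / 2) - gen i (v / 2)" using gen_le_exp[of "v / 2" i] v by simp
    qed simp
    also have "\<dots> = exp v - (gen i (v / 2))\<^sup>2"
      using exp_double[of "v / 2"] by (simp add: power2_eq_square algebra_simps)
    finally show "0 \<le> exp v - (gen i (v / 2))\<^sup>2 - K (Suc i) * (i + 2) * v ^ (i + 1)" by simp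
  qed
  then have "K (Suc i) * u ^ (i + 2) \<le> exp u - gen (Suc i) u" by simp
  then show ?case by (simp add: K_def del: fact_Suc)
qed

text \<open>
  It suffices that the root is filled and that one fixed subtree is high. Ignoring the other subtree is
  harmless when \<open>2 ^ r\<close> is only polynomial in \<open>log 2 n\<close>, as are then all factors lost here.
\<close>

lemma poisson_tail_levels:
  assumes u: "0 \<le> u" and w: "0 \<le> w"
  shows "(1 - exp (- w)) ^ r * (1 - poisson_cdf i u) \<le> 1 - poisson_cdf (i + r) (2 ^ r * u + (2 ^ r - 1) * w)"
proof (induction r)
  case (Suc r)
  let ?z = "2 ^ r * u + (2 ^ r - 1) * w"
  have z: "0 \<le> ?z" using u w by auto
  have sq: "(poisson_cdf (i + r) ?z)\<^sup>2 \<le> poisson_cdf (i + r) ?z"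
    using poisson_cdf_nonneg[OF z] poisson_cdf_le_1[OF z]
    by (simp add: power2_eq_square mult_left_le_one_le)
  have e: "0 \<le> 1 - exp (- w)" using w by simp
  have "poisson_cdf (Suc (i + r)) (2 * ?z + w) \<le> exp (- w) + (1 - exp (- w)) * (poisson_cdf (i + r) ?z)\<^sup>2"
    by (rule poisson_cdf_step[OF z w])
  also have "\<dots> \<le> exp (- w) + (1 - exp (- w)) * poisson_cdf (i + r) ?z"
    using sq e by (intro add_left_mono mult_left_mono) auto
  finally have "(1 - exp (- w)) * (1 - poisson_cdf (i + r) ?z) \<le> 1 - poisson_cdf (Suc (i + r)) (2 * ?z + w)"
    by (simp add: algebra_simps)
  with mult_left_mono[OF Suc.IH e] have "(1 - exp (- w)) ^ Suc r * (1 - poisson_cdf i u)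
      \<le> 1 - poisson_cdf (Suc (i + r)) (2 * ?z + w)"
    by (simp only: power_Suc mult.assoc)
  moreover have "2 * ?z + w = 2 ^ Suc r * u + (2 ^ Suc r - 1) * w" by (simp add: algebra_simps)
  ultimately show ?case by (simp only: add_Suc_right)
qed simp

text \<open>
  Without the term \<open>exp (- w)\<close> of \<open>poisson_cdf_step\<close>, the exponent \<open>a\<close> would double on each level. That
  term, with \<open>w = W\<close>, costs at most \<open>\<eta> = exp (- W / 2)\<close> in the exponent as long as the exponent is below
  \<open>W / 4\<close>, so the exponent minus \<open>\<eta>\<close> still doubles.
\<close>

lemma poisson_cdf_squaring:
  assumes z: "0 \<le> z" and W: "0 \<le> W"
      and small: "2 ^ D * a \<le> W / 4" and start: "poisson_cdf h z \<le> exp (- a)" and a: "0 \<le> a"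
  shows "poisson_cdf (h + D) (2 ^ D * z + (2 ^ D - 1) * W) \<le> exp (2 ^ D * exp (- W / 2) - 2 ^ D * a)"
proof -
  define \<eta> where "\<eta> = exp (- W / 2)"
  have "poisson_cdf (h + j) (2 ^ j * z + (2 ^ j - 1) * W) \<le> exp ((2 ^ j - 1) * \<eta> - 2 ^ j * a)" if "j \<le> D" for j
    using that
  proof (induction j)
    case (Suc j)
    let ?z = "2 ^ j * z + (2 ^ j - 1) * W" and ?b = "2 ^ j * a - (2 ^ j - 1) * \<eta>"
    have z': "0 \<le> ?z" using z W by auto
    have "2 * (2 ^ j * a) \<le> 2 ^ D * a"
      using power_increasing[of "Suc j" D "2 :: real"] Suc.prems
        mult_right_mono[OF _ a, of "2 * 2 ^ j" "2 ^ D"] by simp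
    moreover have "0 \<le> (2 ^ j - 1) * \<eta>" by (simp add: \<eta>_def)
    ultimately have b: "2 * ?b \<le> W / 2" using small W by simp
    have "poisson_cdf (Suc (h + j)) (2 * ?z + W)
        \<le> exp (- W) + (1 - exp (- W)) * (poisson_cdf (h + j) ?z)\<^sup>2"
      by (rule poisson_cdf_step[OF z' W])
    also have "\<dots> \<le> exp (- W) + 1 * (exp (- ?b))\<^sup>2"
      using Suc z' W by (intro add_left_mono mult_mono power_mono poisson_cdf_nonneg) auto
    also have "\<dots> = exp (- 2 * ?b) * (1 + exp (2 * ?b - W))"
      by (simp add: distrib_left exp_add[symmetric] exp_double[symmetric])
    also have "\<dots> \<le> exp (- 2 * ?b) * exp (exp (2 * ?b - W))"
      by (intro mult_left_mono exp_ge_add_one_self) auto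
    also have "\<dots> \<le> exp (- 2 * ?b) * exp \<eta>"
      using b by (intro mult_left_mono) (auto simp: \<eta>_def)
    also have "\<dots> = exp ((2 ^ Suc j - 1) * \<eta> - 2 ^ Suc j * a)"
      by (simp add: exp_add[symmetric] algebra_simps)
    finally show ?case by (simp add: algebra_simps)
  qed (use start in simp)
  from this[of D] have "poisson_cdf (h + D) (2 ^ D * z + (2 ^ D - 1) * W) \<le> exp ((2 ^ D - 1) * \<eta> - 2 ^ D * a)"
    by simp
  also have "\<dots> \<le> exp (2 ^ D * \<eta> - 2 ^ D * a)" by (simp add: \<eta>_def)
  finally show ?thesis by (simp add: \<eta>_def)
qed

text \<open>
  A Poisson variable of mean \<open>n\<close> takes the value \<open>n\<close> with probability of order \<open>n powr (- 1 / 2)\<close>; the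
  weaker bound \<open>1 / (exp 1 * n)\<close> follows from \<open>fact_upper\<close> and is enough, because it is applied to
  probabilities that decay faster than every power of \<open>n\<close>.
\<close>

lemma height_cdf_le_poisson:
  assumes "1 \<le> n"
  shows "height_cdf h n \<le> exp 1 * n * poisson_cdf h n"
proof -
  have nn: "0 < real n" using assms by simp
  have coeff_le: "height_cdf h n / fact n * real n ^ n \<le> gen h n"
  proof (cases "n < 2 ^ h")
    case True
    have "height_cdf h n / fact n * real n ^ n \<le> (\<Sum>m<2 ^ h. height_cdf h m / fact m * real n ^ m)"
      by (rule member_le_sum) (use True height_cdf_nonneg in auto)
    also have "\<dots> = gen h n" by (simp add: gen_def gen_poly_def poly_sum poly_monom)
    finally show ?thesis .
  next
    case False
    then show ?thesis using gen_ge_1[of n h] by (simp add: height_cdf_eq_0)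
  qed
  have "height_cdf h n = height_cdf h n / fact n * real n ^ n * (fact n / real n ^ n)"
    using nn by simp
  also have "\<dots> \<le> gen h n * (fact n / real n ^ n)"
    by (intro mult_right_mono coeff_le) auto
  also have "\<dots> \<le> gen h n * (exp 1 * n * (n / exp 1) ^ n / real n ^ n)"
    using gen_ge_1[of n h] by (intro mult_left_mono divide_right_mono fact_upper assms) auto
  also have "\<dots> = exp 1 * n * poisson_cdf h n"
    using nn by (simp add: poisson_cdf_def power_divide exp_minus exp_of_nat_mult[symmetric] field_simps)
  finally show ?thesis .
qed

text \<open>
  The three estimates combined. The bottom part has \<open>i\<close> levels and mean size about \<open>y \<le> 1\<close>, the middle part
  \<open>r\<close> levels with delay \<open>w = 1 / 16\<close>, the top part \<open>D\<close> levels with delay \<open>W = 2 ^ r / 16\<close>. Measured at the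
  bottom, the delays reduce the mean \<open>y\<close> by at most \<open>w + W / 2 ^ r = 1 / 8\<close>, hence to no less than
  \<open>3 * y / 4\<close>. The hypothesis asks that \<open>2 ^ D\<close> times the tail after the middle part be at least \<open>W / 4\<close>,
  the largest final exponent that \<open>poisson_cdf_squaring\<close> admits.
\<close>

lemma height_cdf_lower_levels:
  fixes n D r i :: nat
  defines "y \<equiv> n / 2 ^ (D + r)"
  assumes n: "1 \<le> n" and y: "1 / 2 \<le> y" "y \<le> 1"
    and large: "2 ^ r / 64 \<le> 2 ^ D * ((1 / 32) ^ r * (1 / 4 *
       (2 powr (real i - real i * (real i + 1) / 2) * (3 * y / 4) ^ (i + 1) / fact (i + 1))))"
  shows "height_cdf (i + r + D) n \<le> exp 1 * real n * exp (2 ^ D * exp (- (2 ^ r / 32)) - 2 ^ r / 64)"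
proof -
  define u w W where "u = y - 1 / 8" and "w = (1 / 16 :: real)" and "W = (2 ^ r / 16 :: real)"
  define a where "a = (2 ^ r / 64 / 2 ^ D :: real)"
  define z where "z = 2 ^ r * u + (2 ^ r - 1) * w"
  define K where "K = 2 powr (real i - real i * (real i + 1) / 2) / fact (i + 1)"
  have u: "3 * y / 4 \<le> u" "0 \<le> u" "u \<le> 1" using y by (auto simp: u_def)
  have w: "0 \<le> w" and W: "0 \<le> W" and a: "0 \<le> a" by (auto simp: w_def W_def a_def)
  have z: "0 \<le> z" using u w by (simp add: z_def)
  have "exp u \<le> exp 1" using u by simp
  then have "exp u \<le> 4" using exp_le by linarith
  then have "1 / 4 \<le> exp (- u)" by (simp add: exp_minus field_simps)
  moreover have "K * (3 * y / 4) ^ (i + 1) \<le> exp u - gen i u"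
  proof -
    have "K * (3 * y / 4) ^ (i + 1) \<le> K * u ^ (i + 1)"
      using u y by (intro mult_left_mono power_mono) (auto simp: K_def)
    also have "\<dots> \<le> exp u - gen i u"
      using gen_gap[OF u(2), of i] by (simp only: K_def times_divide_eq_left)
    finally show ?thesis .
  qed
  moreover have "0 \<le> K * (3 * y / 4) ^ (i + 1)" using y by (simp add: K_def)
  ultimately have "1 / 4 * (K * (3 * y / 4) ^ (i + 1)) \<le> exp (- u) * (exp u - gen i u)"
    by (intro mult_mono) auto
  also have "\<dots> = 1 - poisson_cdf i u"
    by (simp add: poisson_cdf_def right_diff_distrib exp_minus)
  finally have bottom: "1 / 4 * (K * (3 * y / 4) ^ (i + 1)) \<le> 1 - poisson_cdf i u" .
  have "1 + w \<le> exp w" by (rule exp_ge_add_one_self)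
  then have "32 \<le> 31 * exp w" by (simp add: w_def)
  then have ew: "1 / 32 \<le> 1 - exp (- w)" by (simp add: exp_minus field_simps)
  have "(1 / 32) ^ r * (1 / 4 * (K * (3 * y / 4) ^ (i + 1))) \<le> (1 - exp (- w)) ^ r * (1 - poisson_cdf i u)"
    using ew bottom y w by (intro mult_mono power_mono zero_le_power) (auto simp: K_def)
  also have "\<dots> \<le> 1 - poisson_cdf (i + r) z"
    unfolding z_def by (rule poisson_tail_levels[OF u(2) w])
  finally have middle: "(1 / 32) ^ r * (1 / 4 * (K * (3 * y / 4) ^ (i + 1))) \<le> 1 - poisson_cdf (i + r) z" .
  have "a * 2 ^ D \<le> (1 - poisson_cdf (i + r) z) * 2 ^ D"
  proof -
    have "a * 2 ^ D = 2 ^ r / 64" by (simp add: a_def)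
    also have "\<dots> \<le> (1 / 32) ^ r * (1 / 4 * (K * (3 * y / 4) ^ (i + 1))) * 2 ^ D"
      using large by (simp add: K_def mult_ac)
    also have "\<dots> \<le> (1 - poisson_cdf (i + r) z) * 2 ^ D"
      using middle by (rule mult_right_mono) simp
    finally show ?thesis .
  qed
  then have "a \<le> 1 - poisson_cdf (i + r) z" by simp
  then have start: "poisson_cdf (i + r) z \<le> exp (- a)"
    using exp_ge_add_one_self[of "- a"] by linarith
  \<comment> \<open>The means at the three stages are \<open>u\<close>, \<open>z\<close> and this value, which the choice of \<open>u\<close> keeps below \<open>n\<close>.\<close>
  have "2 ^ D * z + (2 ^ D - 1) * W = n - 2 ^ D / 16 - W"
    by (simp add: z_def u_def w_def W_def y_def power_add field_simps)
  moreover have "(0 :: real) \<le> 2 ^ D" by simp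
  ultimately have "2 ^ D * z + (2 ^ D - 1) * W \<le> n" using W by linarith
  then have "poisson_cdf (i + r + D) n \<le> poisson_cdf (i + r + D) (2 ^ D * z + (2 ^ D - 1) * W)"
    using z W by (intro poisson_cdf_antimono) auto
  also have "\<dots> \<le> exp (2 ^ D * exp (- W / 2) - 2 ^ D * a)"
    by (rule poisson_cdf_squaring[OF z W _ start a]) (simp add: a_def W_def)
  also have "\<dots> = exp (2 ^ D * exp (- (2 ^ r / 32)) - 2 ^ r / 64)"
    by (simp add: a_def W_def)
  finally have "poisson_cdf (i + r + D) n \<le> exp (2 ^ D * exp (- (2 ^ r / 32)) - 2 ^ r / 64)" .
  then have "exp 1 * n * poisson_cdf (i + r + D) n \<le> exp 1 * real n * exp (2 ^ D * exp (- (2 ^ r / 32)) - 2 ^ r / 64)"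
    by (intro mult_left_mono) auto
  with height_cdf_le_poisson[OF n] show ?thesis by (rule order_trans)
qed

section \<open>The threshold\<close>

text \<open>
  The exponents to base 2 in the hypothesis of \<open>height_cdf_lower_levels\<close>. Here \<open>l\<close> stands for \<open>log 2 S\<close>, \<open>a\<close> for
  \<open>1 / ln 2\<close>, \<open>t\<close> for \<open>log 2 y\<close>, \<open>q\<close> for \<open>log 2 (i + 1)\<close>, and \<open>t - 1 / 2\<close> bounds \<open>log 2 (3 * y / 4)\<close>.
  The terms of order \<open>S\<^sup>2\<close>, \<open>S l\<close> and \<open>S\<close> cancel up to a perfect square; one factor of \<open>2 ^ i\<close>, reduced to
  \<open>2 powr (i / 2)\<close> by the loss of a quarter of the mean, remains and dominates \<open>2 powr (7 * r)\<close>.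
\<close>

lemma below_threshold_exponent:
  fixes S l a t i r D q :: real
  assumes i: "0 \<le> i" "S - l + a - 3 / 2 < i - t" "i - t \<le> S - l + a - 1 / 2"
    and t: "-1 < t" "t \<le> 0" and l: "2 \<le> l" "60 * l + 10 \<le> S" and a: "1 \<le> a" "a \<le> 3 / 2"
    and q: "q \<le> l" and r: "r < 4 * l - 1" and D: "S\<^sup>2 / 2 \<le> D + r"
  shows "r - 6 \<le> D - 5 * r - 2 + (i - i * (i + 1) / 2) + (i + 1) * (t - 1 / 2)
      - (a + q + (i + 1) * (q - a))"
proof -
  define m where "m = S - l + a - 1 / 2"
  have "(i + 1) * (q - a) \<le> (i + 1) * (l - a)" using q i by (intro mult_left_mono) auto
  also have "\<dots> \<le> (m + 1) * (l - a)" using i t l a by (intro mult_right_mono) (auto simp: m_def)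
  finally have 1: "(i + 1) * (q - a) \<le> (m + 1) * (l - a)" .
  have "(i - t) * (i - t + 1) \<le> m * (m + 1)"
    using i t by (intro mult_mono) (auto simp: m_def)
  moreover have "- (i * (i + 1) / 2) + (i + 1) * t = t * (t + 1) / 2 - (i - t) * (i - t + 1) / 2"
    by (simp add: field_simps)
  moreover have "- 1 / 4 \<le> t * (t + 1)"
    using zero_le_power2[of "t + 1 / 2"] by (simp add: power2_eq_square field_simps)
  ultimately have 2: "- (m * (m + 1) / 2) - 1 / 8 \<le> - (i * (i + 1) / 2) + (i + 1) * t"
    by linarith
  \<comment> \<open>The main terms cancel up to a perfect square, so their sum has the right sign.\<close>
  have "S\<^sup>2 / 2 - m * (m + 1) / 2 - (m + 1) * (l - a) = (l - a - 1 / 2)\<^sup>2 / 2"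
    by (simp add: m_def power2_eq_square field_simps)
  then have 3: "m * (m + 1) / 2 + (m + 1) * (l - a) \<le> S\<^sup>2 / 2"
    using zero_le_power2[of "l - a - 1 / 2"] by linarith
  have 4: "(i + 1) * (t - 1 / 2) = (i + 1) * t - i / 2 - 1 / 2" by (simp add: algebra_simps)
  show ?thesis
    unfolding 4 using 1 2 3 i(2) t r D l a q by linarith
qed

text \<open>
  The bottom part starts at level \<open>D + r = \<lceil>L\<rceil>\<close>, where the mean size drops below 1, and the middle part has
  \<open>r = \<lceil>2 * log 2 L\<rceil>\<close> levels: then the delay \<open>W\<close> of order \<open>L\<^sup>2\<close> makes \<open>exp (- W)\<close> smaller than every power of
  \<open>n\<close>, whereas the factors lost on these levels amount to a power of \<open>L\<close> only.
\<close>

lemma height_cdf_below_threshold: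
  fixes n k :: nat
  defines "L \<equiv> log 2 n"
  defines "S \<equiv> sqrt (2 * L)"
  assumes n: "2 \<le> n" and S2: "2 \<le> log 2 S" and S60: "60 * log 2 S + 10 \<le> S"
    and k: "L + S - log 2 S + 1 / ln 2 - 3 / 2 < k" "k \<le> L + S - log 2 S + 1 / ln 2 - 1 / 2"
  shows "height_cdf k n \<le> exp 1 * real n * exp (2 * real n * exp (- (L\<^sup>2 / 32)) - L\<^sup>2 / 64)"
proof -
  define l a where "l = log 2 S" and "a = 1 / ln (2 :: real)"
  have L0: "0 < L" using n by (simp add: L_def)
  have LS: "L = S\<^sup>2 / 2" using L0 by (simp add: S_def)
  have S0: "0 < S" using L0 by (simp add: S_def)
  have a: "1 \<le> a" "a \<le> 3 / 2"
    using ln_2_less_1 ln2_ge_two_thirds by (auto simp: a_def field_simps)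
  have l: "2 \<le> l" "60 * l + 10 \<le> S" using S2 S60 by (auto simp: l_def)
  have logL2: "2 * log 2 L = 4 * l - 2"
    using S0 by (simp add: LS l_def log_divide log_nat_power)
  have SL: "10 * S \<le> L"
    unfolding LS power2_eq_square using l by (simp add: field_simps)
  define d r where "d = nat \<lceil>L\<rceil>" and "r = nat \<lceil>2 * log 2 L\<rceil>"
  have d: "L \<le> d" "d < L + 1" using L0 by (auto simp: d_def) linarith+
  have r: "4 * l - 2 \<le> r" "r < 4 * l - 1"
  proof -
    have "0 \<le> \<lceil>4 * l - 2\<rceil>" unfolding zero_le_ceiling using l by linarith
    then have "real r = of_int \<lceil>4 * l - 2\<rceil>" by (simp add: r_def logL2)
    then show "4 * l - 2 \<le> r" "r < 4 * l - 1"
      using ceiling_correct[of "4 * l - 2"] by linarith+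
  qed
  have rd: "r \<le> d" using r d l SL by linarith
  have kd: "d \<le> k" using k(1) d l a unfolding l_def[symmetric] a_def[symmetric] by linarith
  define D i where "D = d - r" and "i = k - d"
  have Dr: "D + r = d" using rd by (simp add: D_def)
  have k_eq: "k = i + r + D" using kd Dr unfolding i_def by linarith
  define t y where "t = L - d" and "y = n / 2 ^ (D + r)"
  have t: "-1 < t" "t \<le> 0" using d unfolding t_def by linarith+
  have nL: "2 powr L = n" using n by (simp add: L_def)
  have y_eq: "y = 2 powr t"
    unfolding y_def Dr t_def powr_diff nL by (simp add: powr_realpow)
  have y: "1 / 2 \<le> y" "y \<le> 1"
  proof -
    have "2 powr (- 1) \<le> y" unfolding y_eq using t by (intro powr_mono) auto
    then show "1 / 2 \<le> y" by (simp add: powr_minus)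
    have "y \<le> 2 powr 0" unfolding y_eq using t by (intro powr_mono) auto
    then show "y \<le> 1" by simp
  qed
  define v where "v = real i + 1"
  define m where "m = S - l + a - 1 / 2"
  have it: "i - t \<le> m" "m - 1 < i - t"
    using k kd unfolding l_def[symmetric] a_def[symmetric] by (auto simp: t_def i_def m_def)
  have i0: "0 \<le> real i" by simp
  have v: "1 \<le> v" "v \<le> m + 1" "m + 1 \<le> S" using it t l a by (auto simp: v_def m_def)
  have fact_le: "fact (i + 1) \<le> 2 powr (a + log 2 v + v * (log 2 v - a))"
  proof -
    have vi: "real (i + 1) = v" by (simp add: v_def)
    have "1 \<le> i + 1" by simp
    from fact_le_powr[OF this, unfolded vi] show ?thesis unfolding a_def .
  qed
  have half: "2 powr (- 1 / 2) \<le> (3 / 4 :: real)"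
  proof (rule power2_le_imp_le)
    have "(2 powr (- 1 / 2))\<^sup>2 = (2 powr (- 1) :: real)"
      unfolding power2_eq_square powr_add[symmetric] by simp
    also have "\<dots> = 1 / 2" by (simp add: powr_minus)
    finally show "(2 powr (- 1 / 2))\<^sup>2 \<le> (3 / 4 :: real)\<^sup>2" by (simp add: power2_eq_square)
  qed simp
  have y34: "2 powr (v * (t - 1 / 2)) \<le> (3 * y / 4) ^ (i + 1)"
  proof -
    have "2 powr (t - 1 / 2) \<le> 3 * y / 4"
    proof -
      have "2 powr (t - 1 / 2) = y * 2 powr (- 1 / 2)" by (simp add: y_eq powr_add[symmetric])
      also have "\<dots> \<le> y * (3 / 4)" using half y by (intro mult_left_mono) auto
      finally show ?thesis by simp
    qed
    then have "(2 powr (t - 1 / 2)) ^ (i + 1) \<le> (3 * y / 4) ^ (i + 1)"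
      by (intro power_mono) auto
    moreover have "(2 powr (t - 1 / 2)) ^ (i + 1) = 2 powr (v * (t - 1 / 2))"
      by (simp only: powr_power v_def) (simp add: mult.commute add.commute)
    ultimately show ?thesis by simp
  qed
  have lv: "log 2 v \<le> l" using v S0 unfolding l_def by (intro log_mono) auto
  have expo: "real r - 6 \<le> real D - 5 * real r - 2 + (real i - real i * (real i + 1) / 2) + v * (t - 1 / 2)
      - (a + log 2 v + v * (log 2 v - a))"
    unfolding v_def
  proof (rule below_threshold_exponent)
    show "S\<^sup>2 / 2 \<le> real D + r" using d Dr LS by simp
    show "S - l + a - 3 / 2 < real i - t" "real i - t \<le> S - l + a - 1 / 2"
      using it by (auto simp: m_def)
  qed (use r t l a lv in \<open>auto simp: v_def\<close>)
  have "2 ^ r / 64 = 2 powr (real r - 6)"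
    by (simp add: powr_diff powr_realpow)
  also have "\<dots> \<le> 2 powr (real D - 5 * real r - 2 + (real i - real i * (real i + 1) / 2) + v * (t - 1 / 2)
      - (a + log 2 v + v * (log 2 v - a)))"
    using expo by simp
  also have "\<dots> = 2 ^ D * ((1 / 32) ^ r * (1 / 4 *
       (2 powr (real i - real i * (real i + 1) / 2) * 2 powr (v * (t - 1 / 2)) /
         2 powr (a + log 2 v + v * (log 2 v - a)))))"
  proof -
    have "2 powr (5 * real r) = 2 powr (real (5 * r))" by simp
    also have "\<dots> = 2 ^ (5 * r)" by (subst powr_realpow) auto
    also have "(2 :: real) ^ (5 * r) = 32 ^ r" by (simp add: power_mult)
    finally have p5: "2 powr (5 * real r) = (32 :: real) ^ r" .
    have "2 powr (real D - 5 * real r - 2) = 2 ^ D * ((1 / 32) ^ r * (1 / 4 :: real))"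
      by (simp add: powr_diff p5 powr_realpow power_divide)
    moreover have "2 powr (A + B + C - E) = 2 powr A * (2 powr B * 2 powr C / 2 powr E)" for A B C E :: real
      by (simp add: powr_diff powr_add)
    ultimately show ?thesis by (simp only: mult.assoc)
  qed
  also have "\<dots> \<le> 2 ^ D * ((1 / 32) ^ r * (1 / 4 *
       (2 powr (real i - real i * (real i + 1) / 2) * (3 * y / 4) ^ (i + 1) / fact (i + 1))))"
    using y34 fact_le y by (intro mult_left_mono frac_le mult_nonneg_nonneg) auto
  finally have "height_cdf (i + r + D) n \<le> exp 1 * real n * exp (2 ^ D * exp (- (2 ^ r / 32)) - 2 ^ r / 64)"
    using y n unfolding y_def by (intro height_cdf_lower_levels) auto
  also have "\<dots> \<le> exp 1 * real n * exp (2 * real n * exp (- (L\<^sup>2 / 32)) - L\<^sup>2 / 64)"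
  proof -
    have "L\<^sup>2 = 2 powr (log 2 L + log 2 L)"
      unfolding powr_add using L0 by (simp add: power2_eq_square)
    also have "log 2 L + log 2 L = 4 * l - 2" using logL2 by simp
    also have "2 powr (4 * l - 2) \<le> 2 powr r" using r by simp
    finally have Lr: "L\<^sup>2 \<le> 2 ^ r" by (simp add: powr_realpow)
    have "(2 :: real) ^ D \<le> 2 ^ d" by (simp add: D_def)
    also have "\<dots> = 2 powr d" by (simp add: powr_realpow)
    also have "\<dots> \<le> 2 powr (L + 1)" using d by simp
    also have "\<dots> = 2 * real n" by (simp add: powr_add nL)
    finally have "2 ^ D \<le> 2 * real n" .
    then have "2 ^ D * exp (- (2 ^ r / 32)) \<le> 2 * real n * exp (- (L\<^sup>2 / 32))"
      using Lr by (intro mult_mono) auto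
    then show ?thesis using Lr by (intro mult_left_mono) auto
  qed
  finally show ?thesis by (simp add: k_eq)
qed

text \<open>
  The first moment bound with chains of \<open>\<lceil>S\<rceil>\<close> records; the minimum over the length is flat enough for the
  rounding to cost only a constant factor.
\<close>

lemma height_tail_above_threshold:
  fixes n k :: nat
  defines "L \<equiv> log 2 n"
  defines "S \<equiv> sqrt (2 * L)"
  assumes n: "2 \<le> n" and S2: "2 \<le> log 2 S" and Sl: "log 2 S \<le> S"
    and k: "L + S - log 2 S + 1 / ln 2 + 1 / 2 \<le> k"
  shows "1 - height_cdf k n \<le> 2 powr (1 / ln 2 + 1 / 2) / S"
proof -
  define l a where "l = log 2 S" and "a = 1 / ln (2 :: real)"
  have L0: "0 < L" using n by (simp add: L_def)
  have LS: "L = S\<^sup>2 / 2" using L0 by (simp add: S_def)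
  have S0: "0 < S" using L0 by (simp add: S_def)
  have a: "1 \<le> a" using ln_2_less_1 by (auto simp: a_def field_simps)
  have l: "2 \<le> l" "l \<le> S" using S2 Sl by (auto simp: l_def)
  define v where "v = nat \<lceil>S\<rceil>"
  have v: "S \<le> v" "v < S + 1" using S0 by (auto simp: v_def) linarith+
  define f where "f = v - 1"
  have v1: "1 \<le> v" using v l by linarith
  have f: "real f = real v - 1" "v = f + 1" using v1 by (auto simp: f_def)
  have SL: "S \<le> L" using l mult_left_mono[of 2 S S] by (simp add: LS power2_eq_square)
  have fk: "f \<le> k" using k v SL a l f unfolding l_def[symmetric] a_def[symmetric] by linarith
  define m where "m = S - l + a + 1 / 2"
  have choose_le: "real (n choose v) \<le> 2 powr (v * L + v * a - v * log 2 v)"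
  proof -
    have "real (n choose v) * fact v \<le> real n ^ v"
      using binomial_fact_pow[of n v] by (metis of_nat_fact of_nat_le_iff of_nat_mult of_nat_power)
    then have "real (n choose v) \<le> real n ^ v / fact v" by (simp add: field_simps)
    also have "\<dots> \<le> real n ^ v / (v / exp 1) ^ v"
      using v1 by (intro divide_left_mono fact_lower mult_pos_pos) auto
    also have "\<dots> = (n * exp 1 / v) ^ v" by (simp add: power_divide power_mult_distrib)
    also have "n * exp 1 / v = 2 powr (L + a - log 2 v)"
      using v1 n powr_inverse_ln2[of 1] by (simp add: powr_diff powr_add L_def a_def)
    also have "(2 powr (L + a - log 2 v)) ^ v = 2 powr (v * L + v * a - v * log 2 v)"
      by (simp add: powr_power algebra_simps)
    finally show ?thesis .
  qed
  have expo: "real f - real f * (real f + 1) / 2 - real f * real (k - f) + (v * L + v * a - v * log 2 v)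
      \<le> a + 1 / 2 - l"
  proof -
    have e: "real f - real f * (real f + 1) / 2 - real f * real (k - f) + (v * L + v * a - v * log 2 v)
        = L - f * (k - L) + v * (real v - 1) / 2 + v * a - v * log 2 v"
    proof -
      have "real v = real f + 1" using f(1) by simp
      then show ?thesis using fk by (simp add: of_nat_diff field_simps)
    qed
    have "f * m \<le> f * (k - L)"
      using k unfolding l_def[symmetric] a_def[symmetric] m_def by (intro mult_left_mono) auto
    moreover have "v * l \<le> v * log 2 v"
      using v S0 unfolding l_def by (intro mult_left_mono log_mono) auto
    \<comment> \<open>All terms of positive order in \<open>S\<close> cancel here; \<open>v - S\<close> is the rounding error of the length.\<close>
    moreover have "S\<^sup>2 / 2 - f * m + v * (real v - 1) / 2 + v * a - v * l = a + 1 / 2 - l - (v - S) * (1 - (v - S) / 2)"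
      unfolding f(1) m_def by (simp add: power2_eq_square field_simps)
    moreover have "0 \<le> (v - S) * (1 - (v - S) / 2)"
      using v by (intro mult_nonneg_nonneg) auto
    ultimately show ?thesis using LS unfolding e by linarith
  qed
  have "1 - height_cdf k n \<le> 2 powr (real f - real f * (real f + 1) / 2 - real f * real (k - f)) * (n choose v)"
    using height_tail_partial_chain[of f "k - f" n] fk f(2) by simp
  also have "\<dots> \<le> 2 powr (real f - real f * (real f + 1) / 2 - real f * real (k - f)) *
       2 powr (v * L + v * a - v * log 2 v)"
    by (intro mult_left_mono choose_le) auto
  also have "\<dots> \<le> 2 powr (a + 1 / 2 - l)"
    unfolding powr_add[symmetric] using expo by simp
  also have "\<dots> = 2 powr (1 / ln 2 + 1 / 2) / S"
    using S0 by (simp add: powr_diff l_def a_def)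
  finally show ?thesis .
qed

text \<open>
  The form of the threshold in terms of \<open>S\<close>, in which the cancellations take place: as \<open>S\<^sup>2 = 2 L\<close>,
  \<open>log 2 L / 2 = log 2 S - 1 / 2\<close>.
\<close>

lemma k_H_bounds:
  fixes n :: nat
  defines "L \<equiv> log 2 n"
  defines "S \<equiv> sqrt (2 * L)"
  assumes "2 \<le> n"
  shows "k_H n \<le> L + S - log 2 S + 1 / ln 2 + 1 / 2" "L + S - log 2 S + 1 / ln 2 + 1 / 2 < k_H n + 1"
proof -
  have L0: "0 < L" using assms by (simp add: L_def)
  then have "log 2 S = log 2 (2 * L) / 2"
    by (simp add: S_def powr_half_sqrt[symmetric] log_powr)
  also have "\<dots> = 1 / 2 + 1 / 2 * log 2 L" using L0 by (simp add: log_mult field_simps)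
  finally have "k_H n = \<lfloor>L + S - log 2 S + 1 / ln 2 + 1 / 2\<rfloor>"
    by (simp add: k_H_def L_def S_def algebra_simps)
  then show "k_H n \<le> L + S - log 2 S + 1 / ln 2 + 1 / 2" "L + S - log 2 S + 1 / ln 2 + 1 / 2 < k_H n + 1"
    by linarith+
qed

lemma below_threshold_bound_tendsto_0: "((\<lambda>n. exp 1 * real n * exp (2 * real n * exp (- ((log 2 (real n))\<^sup>2 / 32)) - (log 2 (real n))\<^sup>2 / 64)) \<longlongrightarrow> 0) at_top"
proof -
  have "(\<lambda>n. 2 * real n * exp (- ((log 2 (real n))\<^sup>2 / 32))) \<longlonglongrightarrow> 0"
    by real_asymp
  then have "(\<lambda>n. exp (2 * real n * exp (- ((log 2 (real n))\<^sup>2 / 32)))) \<longlonglongrightarrow> exp 0"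
    by (rule tendsto_exp)
  moreover have "(\<lambda>n. exp 1 * real n * exp (- (log 2 (real n))\<^sup>2 / 64)) \<longlonglongrightarrow> 0"
    by real_asymp
  ultimately have "(\<lambda>n. exp (2 * real n * exp (- ((log 2 (real n))\<^sup>2 / 32))) *
       (exp 1 * real n * exp (- (log 2 (real n))\<^sup>2 / 64))) \<longlonglongrightarrow> exp 0 * 0"
    by (rule tendsto_mult)
  then show ?thesis
    by (simp add: diff_conv_add_uminus exp_add mult_ac del: add_uminus_conv_diff)
qed

lemma above_threshold_bound_tendsto_0: "((\<lambda>n. 2 powr (1 / ln 2 + 1 / 2) / sqrt (2 * log 2 (real n))) \<longlongrightarrow> 0) at_top"
  by real_asymp

lemma eventually_log_sqrt_bounds: "eventually (\<lambda>n. 2 \<le> log 2 (sqrt (2 * log 2 (real n)))) at_top"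
  "eventually (\<lambda>n. 60 * log 2 (sqrt (2 * log 2 (real n))) + 10 \<le> sqrt (2 * log 2 (real n))) at_top"
  "eventually (\<lambda>n. log 2 (sqrt (2 * log 2 (real n))) \<le> sqrt (2 * log 2 (real n))) at_top"
  by real_asymp+

lemma prob_two_points:
  fixes K :: int
  assumes rb: "random_bits M n b" and K: "1 \<le> K"
  shows "\<P>(\<omega> in M. int (dst_height n b \<omega>) = K \<or> int (dst_height n b \<omega>) = K + 1) =
         height_cdf (nat (K + 1)) n - height_cdf (nat (K - 1)) n"
proof -
  interpret prob_space M using rb by (simp add: random_bits_def)
  let ?B = "\<lambda>h. {\<omega> \<in> space M. dst_height n b \<omega> \<le> h}"
  have "{\<omega> \<in> space M. int (dst_height n b \<omega>) = K \<or> int (dst_height n b \<omega>) = K + 1}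
      = ?B (nat (K + 1)) - ?B (nat (K - 1))"
    using K by auto
  moreover have "prob (?B (nat (K + 1)) - ?B (nat (K - 1))) = prob (?B (nat (K + 1))) - prob (?B (nat (K - 1)))"
  proof (rule finite_measure_Diff)
    show "?B (nat (K - 1)) \<subseteq> ?B (nat (K + 1))" using K by auto
  qed (rule prob_dst_height_le[OF rb])+
  ultimately show ?thesis by (simp only: prob_dst_height_le[OF rb])
qed

theorem theorem3:
  fixes M :: "nat \<Rightarrow> 'w measure" and b :: "nat \<Rightarrow> nat \<Rightarrow> nat \<Rightarrow> 'w \<Rightarrow> bool"
  assumes "\<And>n. random_bits (M n) n (b n)"
  shows "(\<lambda>n. \<P>(\<omega> in M n. int (dst_height n (b n) \<omega>) = k_H n \<or>
                           int (dst_height n (b n) \<omega>) = k_H n + 1)) \<longlonglongrightarrow> 1"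
proof (rule tendsto_sandwich)
  let ?L = "\<lambda>n. log 2 (real n)" and ?S = "\<lambda>n. sqrt (2 * log 2 (real n))"
  let ?below = "\<lambda>n. exp 1 * real n * exp (2 * real n * exp (- ((?L n)\<^sup>2 / 32)) - (?L n)\<^sup>2 / 64)"
  let ?above = "\<lambda>n. 2 powr (1 / ln 2 + 1 / 2) / ?S n"
  have "(\<lambda>n. 1 - ?above n - ?below n) \<longlonglongrightarrow> 1 - 0 - 0"
    by (intro tendsto_diff tendsto_const above_threshold_bound_tendsto_0 below_threshold_bound_tendsto_0)
  then show "(\<lambda>n. 1 - ?above n - ?below n) \<longlonglongrightarrow> 1" by simp
  show "\<forall>\<^sub>F n in sequentially. 1 - ?above n - ?below n \<le>
      \<P>(\<omega> in M n. int (dst_height n (b n) \<omega>) = k_H n \<or> int (dst_height n (b n) \<omega>) = k_H n + 1)"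
    using eventually_log_sqrt_bounds eventually_ge_at_top[of 2]
  proof eventually_elim
    case (elim n)
    have L: "1 \<le> ?L n" using elim(4) by simp
    have a: "0 < 1 / ln (2 :: real)" by simp
    note K = k_H_bounds[OF elim(4)]
    have "1 < real_of_int (k_H n + 1)"
      using K(2) L a elim(3) by linarith
    then have K1: "1 \<le> k_H n" by simp
    have k1: "real (nat (k_H n - 1)) = real_of_int (k_H n) - 1"
      and k2: "real (nat (k_H n + 1)) = real_of_int (k_H n) + 1"
      using K1 by simp_all
    have "height_cdf (nat (k_H n - 1)) n \<le> ?below n"
    proof (rule height_cdf_below_threshold[OF elim(4) elim(1) elim(2)])
      show "?L n + ?S n - log 2 (?S n) + 1 / ln 2 - 3 / 2 < real (nat (k_H n - 1))"
           "real (nat (k_H n - 1)) \<le> ?L n + ?S n - log 2 (?S n) + 1 / ln 2 - 1 / 2"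
        unfolding k1 using K by linarith+
    qed
    moreover have "1 - height_cdf (nat (k_H n + 1)) n \<le> ?above n"
    proof (rule height_tail_above_threshold[OF elim(4) elim(1) elim(3)])
      show "?L n + ?S n - log 2 (?S n) + 1 / ln 2 + 1 / 2 \<le> real (nat (k_H n + 1))"
        unfolding k2 using K by linarith
    qed
    ultimately show ?case
      unfolding prob_two_points[OF assms K1] by linarith
  qed
  show "\<forall>\<^sub>F n in sequentially.
      \<P>(\<omega> in M n. int (dst_height n (b n) \<omega>) = k_H n \<or> int (dst_height n (b n) \<omega>) = k_H n + 1) \<le> 1"
    using assms by (auto simp: random_bits_def intro!: always_eventually prob_space.prob_le_1)
qed simp

end
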